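(* If $X$ is a countably based consonant topological space, then $\mathbf{A}(\mathbf{K}(X))$, $\mathbf{K}(\mathbf{A}(X))$ and $\mathbf{O}(\mathbf{O}(X))$ are all homeomorphic. Moreover, the topology of each of these three spaces coincides with both the weak topology and the Scott topology (with respect to its order).
   Context: For a topological space $Y$: $\mathbf{A}(Y)$ is the set of all closed subsets of $Y$ with the lower Vietoris topology, generated by the sets $\Diamond U=\{A\in\mathbf{A}(Y)\mid A\cap U\neq\emptyset\}$ for $U\subseteq Y$ open. $\mathbf{K}(Y)$ is the set of all compact saturated subsets of $Y$ with the upper Vietoris topology, generated by the sets $\Box U=\{K\in\mathbf{K}(Y)\mid K\subseteq U\}$ for $U\subseteq Y$ open. (Compact: every open cover has a finite subcover. Saturated: equal to the intersection of all its open neighborhoods.) $\mathbf{O}(Y)$ is the lattice of open subsets of $Y$ ordered by inclusion and equipped with the Scott topology. Orders: each space carries its specialization order ($x\le y$ iff $x$ is in the closure of $\{y\}$). This is subset inclusion on $\mathbf{A}(\mathbf{K}(X))$, reverse subset inclusion on $\mathbf{K}(\mathbf{A}(X))$, and subset inclusion on $\mathbf{O}(\mathbf{O}(X))$. The weak topology on a partially ordered set $P$ is generated by the sets $\{y\in P\mid y\not\le x\}$ for $x\in P$. $X$ is consonant if for every Scott-open $\mathcal{H}\subseteq\mathbf{O}(X)$ and every $U\in\mathcal{H}$ there is $K\in\mathbf{K}(X)$ with $U\in\triangledown K\subseteq\mathcal{H}$, where $\triangledown K=\{V\in\mathbf{O}(X)\mid K\subseteq V\}$. *)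

theory Defs
  imports "HOL-Analysis.Analysis"
begin

definition specialization_le :: "'a topology \<Rightarrow> 'a \<Rightarrow> 'a \<Rightarrow> bool" where
  "specialization_le Y x y \<longleftrightarrow> x \<in> Y closure_of {y}"

text \<open>A partially ordered set is given by a carrier \<open>P\<close> and a relation \<open>le\<close>, of which
  only the restriction to \<open>P\<close> matters.\<close>

definition is_sup_on :: "'a set \<Rightarrow> ('a \<Rightarrow> 'a \<Rightarrow> bool) \<Rightarrow> 'a set \<Rightarrow> 'a \<Rightarrow> bool" where
  "is_sup_on P le D s \<longleftrightarrow>
     s \<in> P \<and> (\<forall>d\<in>D. le d s) \<and> (\<forall>u\<in>P. (\<forall>d\<in>D. le d u) \<longrightarrow> le s u)"

definition directed_on :: "('a \<Rightarrow> 'a \<Rightarrow> bool) \<Rightarrow> 'a set \<Rightarrow> bool" where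
  "directed_on le D \<longleftrightarrow> D \<noteq> {} \<and> (\<forall>x\<in>D. \<forall>y\<in>D. \<exists>z\<in>D. le x z \<and> le y z)"

definition scott_open_on :: "'a set \<Rightarrow> ('a \<Rightarrow> 'a \<Rightarrow> bool) \<Rightarrow> 'a set \<Rightarrow> bool" where
  "scott_open_on P le U \<longleftrightarrow>
     U \<subseteq> P \<and>
     (\<forall>x\<in>U. \<forall>y\<in>P. le x y \<longrightarrow> y \<in> U) \<and>
     (\<forall>D s. D \<subseteq> P \<and> directed_on le D \<and> is_sup_on P le D s \<and> s \<in> U \<longrightarrow> D \<inter> U \<noteq> {})"

definition scott_topology :: "'a set \<Rightarrow> ('a \<Rightarrow> 'a \<Rightarrow> bool) \<Rightarrow> 'a topology" where
  "scott_topology P le = topology (scott_open_on P le)"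

lemma scott_open_onI:
  assumes "U \<subseteq> P"
    and "\<And>x y. x \<in> U \<Longrightarrow> y \<in> P \<Longrightarrow> le x y \<Longrightarrow> y \<in> U"
    and "\<And>D s. D \<subseteq> P \<Longrightarrow> directed_on le D \<Longrightarrow> is_sup_on P le D s \<Longrightarrow> s \<in> U
           \<Longrightarrow> \<exists>d\<in>D. d \<in> U"
  shows "scott_open_on P le U"
  unfolding scott_open_on_def
proof (intro conjI allI ballI impI; (elim conjE)?)
  fix D s assume "D \<subseteq> P" "directed_on le D" "is_sup_on P le D s" "s \<in> U"
  from assms(3)[OF this] show "D \<inter> U \<noteq> {}" by blast
qed (use assms(1,2) in auto)

lemma scott_open_onD:
  assumes "scott_open_on P le U"
  shows "U \<subseteq> P"
    and "x \<in> U \<Longrightarrow> y \<in> P \<Longrightarrow> le x y \<Longrightarrow> y \<in> U"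
    and "D \<subseteq> P \<Longrightarrow> directed_on le D \<Longrightarrow> is_sup_on P le D s \<Longrightarrow> s \<in> U \<Longrightarrow> \<exists>d\<in>D. d \<in> U"
proof -
  show "U \<subseteq> P" and "x \<in> U \<Longrightarrow> y \<in> P \<Longrightarrow> le x y \<Longrightarrow> y \<in> U"
    using assms by (simp_all add: scott_open_on_def)
  assume "D \<subseteq> P" "directed_on le D" "is_sup_on P le D s" "s \<in> U"
  then have "D \<inter> U \<noteq> {}"
    using assms unfolding scott_open_on_def by meson
  then show "\<exists>d\<in>D. d \<in> U" by blast
qed

lemma istopology_scott_open_on: "istopology (scott_open_on P le)"
  unfolding istopology_def
proof (intro conjI allI impI)
  fix U V assume U: "scott_open_on P le U" and V: "scott_open_on P le V"
  show "scott_open_on P le (U \<inter> V)"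
  proof (rule scott_open_onI)
    show "U \<inter> V \<subseteq> P"
      using scott_open_onD(1)[OF U] by blast
    show "y \<in> U \<inter> V" if "x \<in> U \<inter> V" "y \<in> P" "le x y" for x y
      using that scott_open_onD(2)[OF U, of x y] scott_open_onD(2)[OF V, of x y] by simp
    fix D s
    assume D: "D \<subseteq> P" "directed_on le D" "is_sup_on P le D s" and s: "s \<in> U \<inter> V"
    obtain u where u: "u \<in> D" "u \<in> U"
      using scott_open_onD(3)[OF U D] s by auto
    obtain v where v: "v \<in> D" "v \<in> V"
      using scott_open_onD(3)[OF V D] s by auto
    obtain z where z: "z \<in> D" "le u z" "le v z"
      using D(2) u(1) v(1) unfolding directed_on_def by meson
    have "z \<in> P" using z(1) D(1) by (rule subsetD[rotated])
    then have "z \<in> U \<inter> V"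
      using scott_open_onD(2)[OF U u(2) _ z(2)] scott_open_onD(2)[OF V v(2) _ z(3)] by simp
    with z(1) show "\<exists>d\<in>D. d \<in> U \<inter> V" by (rule bexI[rotated])
  qed
next
  fix \<K> assume K: "\<forall>K\<in>\<K>. scott_open_on P le K"
  show "scott_open_on P le (\<Union>\<K>)"
  proof (rule scott_open_onI)
    show "\<Union>\<K> \<subseteq> P"
      using K by (meson Union_least scott_open_onD(1))
    show "y \<in> \<Union>\<K>" if "x \<in> \<Union>\<K>" "y \<in> P" "le x y" for x y
      using that K scott_open_onD(2) by (meson UnionE UnionI)
    fix D s
    assume D: "D \<subseteq> P" "directed_on le D" "is_sup_on P le D s" and "s \<in> \<Union>\<K>"
    then obtain W where W: "W \<in> \<K>" "s \<in> W" by (rule_tac UnionE)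
    have "\<exists>d\<in>D. d \<in> W"
      using K W(1) by (intro scott_open_onD(3)[OF _ D W(2)]) simp
    with W(1) show "\<exists>d\<in>D. d \<in> \<Union>\<K>" by auto
  qed
qed

lemma openin_scott_topology: "openin (scott_topology P le) U \<longleftrightarrow> scott_open_on P le U"
  by (simp add: scott_topology_def istopology_scott_open_on)

lemma topspace_scott_topology [simp]: "topspace (scott_topology P le) = P"
proof
  show "topspace (scott_topology P le) \<subseteq> P"
    by (auto simp: topspace_def openin_scott_topology scott_open_on_def)
  have "scott_open_on P le P"
    by (auto simp: scott_open_on_def directed_on_def)
  then show "P \<subseteq> topspace (scott_topology P le)"
    using openin_scott_topology openin_subset by blast
qed

text \<open>The library constant \<open>topology_generated_by\<close> takes the union of the generators as the
  underlying set. Since the given generators need not cover the intended carrier (the empty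
  closed set lies in no \<open>\<diamond>U\<close>, a least element in no generator of the weak topology),
  the carrier is added to them.\<close>

definition weak_topology :: "'a set \<Rightarrow> ('a \<Rightarrow> 'a \<Rightarrow> bool) \<Rightarrow> 'a topology" where
  "weak_topology P le = topology_generated_by (insert P {{y \<in> P. \<not> le y x} | x. x \<in> P})"

lemma topspace_weak_topology [simp]: "topspace (weak_topology P le) = P"
  by (auto simp: weak_topology_def)

definition lower_powerspace :: "'a topology \<Rightarrow> 'a set topology" where
  "lower_powerspace Y =
     topology_generated_by
       (insert {A. closedin Y A} {{A. closedin Y A \<and> A \<inter> U \<noteq> {}} | U. openin Y U})"

lemma topspace_lower_powerspace [simp]: "topspace (lower_powerspace Y) = {A. closedin Y A}"
  by (auto simp: lower_powerspace_def)

definition saturatedin :: "'a topology \<Rightarrow> 'a set \<Rightarrow> bool" where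
  "saturatedin Y K \<longleftrightarrow> K = \<Inter>{U. openin Y U \<and> K \<subseteq> U}"

definition upper_powerspace :: "'a topology \<Rightarrow> 'a set topology" where
  "upper_powerspace Y =
     topology_generated_by {{K. compactin Y K \<and> saturatedin Y K \<and> K \<subseteq> U} | U. openin Y U}"

lemma topspace_upper_powerspace [simp]:
  "topspace (upper_powerspace Y) = {K. compactin Y K \<and> saturatedin Y K}"
proof -
  have "\<exists>S \<in> {{K. compactin Y K \<and> saturatedin Y K \<and> K \<subseteq> U} | U. openin Y U}. K \<in> S"
    if "compactin Y K" "saturatedin Y K" for K
    using that compactin_subset_topspace[OF that(1)]
    by (intro bexI[of _ "{K. compactin Y K \<and> saturatedin Y K \<and> K \<subseteq> topspace Y}"]) auto
  then show ?thesis
    unfolding upper_powerspace_def topology_generated_by_topspace by auto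
qed

definition open_set_space :: "'a topology \<Rightarrow> 'a set topology" where
  "open_set_space Y = scott_topology {U. openin Y U} (\<subseteq>)"

lemma topspace_open_set_space [simp]: "topspace (open_set_space Y) = {U. openin Y U}"
  by (simp add: open_set_space_def)

definition consonant :: "'a topology \<Rightarrow> bool" where
  "consonant X \<longleftrightarrow>
     (\<forall>\<H> U. openin (open_set_space X) \<H> \<and> U \<in> \<H> \<longrightarrow>
        (\<exists>K \<in> topspace (upper_powerspace X).
           U \<in> {V. openin X V \<and> K \<subseteq> V} \<and> {V. openin X V \<and> K \<subseteq> V} \<subseteq> \<H>))"

lemma specialization_leD:
  assumes "specialization_le Y x y" "openin Y T" "x \<in> T"
  shows "y \<in> T"
  using assms by (auto simp: specialization_le_def in_closure_of)

lemma generate_topology_on_mono_point: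
  assumes "generate_topology_on \<S> T" "x \<in> T" "\<And>S. S \<in> \<S> \<Longrightarrow> x \<in> S \<Longrightarrow> y \<in> S"
  shows "y \<in> T"
  using assms by (induction rule: generate_topology_on.induct) auto

lemma specialization_le_lower_powerspace:
  assumes "closedin Y A" "closedin Y B"
  shows "specialization_le (lower_powerspace Y) A B \<longleftrightarrow> A \<subseteq> B"
proof
  assume le: "specialization_le (lower_powerspace Y) A B"
  show "A \<subseteq> B"
  proof (rule ccontr)
    assume "\<not> A \<subseteq> B"
    let ?U = "topspace Y - B"
    let ?T = "{A. closedin Y A \<and> A \<inter> ?U \<noteq> {}}"
    have "openin Y ?U" using assms(2) by blast
    then have "openin (lower_powerspace Y) ?T"
      unfolding lower_powerspace_def by (intro topology_generated_by_Basis) blast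
    moreover have "A \<in> ?T"
      using assms closedin_subset[OF assms(1)] \<open>\<not> A \<subseteq> B\<close> by blast
    ultimately have "B \<in> ?T"
      by (rule specialization_leD[OF le])
    then show False by blast
  qed
next
  assume sub: "A \<subseteq> B"
  have "B \<in> T" if "A \<in> T" "openin (lower_powerspace Y) T" for T
    using that(2) unfolding lower_powerspace_def openin_topology_generated_by_iff
    by (rule generate_topology_on_mono_point[OF _ that(1)]) (use sub assms in auto)
  then show "specialization_le (lower_powerspace Y) A B"
    using assms by (auto simp: specialization_le_def in_closure_of)
qed

lemma specialization_le_upper_powerspace:
  assumes "compactin Y K" "saturatedin Y K" "compactin Y L" "saturatedin Y L"
  shows "specialization_le (upper_powerspace Y) K L \<longleftrightarrow> L \<subseteq> K"
proof
  assume le: "specialization_le (upper_powerspace Y) K L"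
  have "L \<subseteq> U" if "openin Y U" "K \<subseteq> U" for U
  proof -
    let ?T = "{K. compactin Y K \<and> saturatedin Y K \<and> K \<subseteq> U}"
    have "openin (upper_powerspace Y) ?T"
      unfolding upper_powerspace_def using that by (intro topology_generated_by_Basis) blast
    moreover have "K \<in> ?T" using assms that by blast
    ultimately have "L \<in> ?T"
      by (rule specialization_leD[OF le])
    then show ?thesis by blast
  qed
  then have "L \<subseteq> \<Inter>{U. openin Y U \<and> K \<subseteq> U}" by blast
  then show "L \<subseteq> K" using assms(2) unfolding saturatedin_def by simp
next
  assume sub: "L \<subseteq> K"
  have "L \<in> T" if "K \<in> T" "openin (upper_powerspace Y) T" for T
    using that(2) unfolding upper_powerspace_def openin_topology_generated_by_iff
    by (rule generate_topology_on_mono_point[OF _ that(1)]) (use sub assms in auto)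
  then show "specialization_le (upper_powerspace Y) K L"
    using assms by (auto simp: specialization_le_def in_closure_of)
qed

lemma specialization_le_open_set_space:
  assumes "openin Y U" "openin Y V"
  shows "specialization_le (open_set_space Y) U V \<longleftrightarrow> U \<subseteq> V"
proof
  assume le: "specialization_le (open_set_space Y) U V"
  let ?T = "{W. openin Y W \<and> \<not> W \<subseteq> V}"
  have "scott_open_on {U. openin Y U} (\<subseteq>) ?T"
  proof (rule scott_open_onI)
    fix D s
    assume "is_sup_on {U. openin Y U} (\<subseteq>) D s" "s \<in> ?T" and D: "D \<subseteq> {U. openin Y U}"
    then have "\<not> (\<forall>d\<in>D. d \<subseteq> V)"
      using assms(2) by (metis (no_types, lifting) is_sup_on_def mem_Collect_eq)
    with D show "\<exists>d\<in>D. d \<in> ?T" by auto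
  qed auto
  then have "openin (open_set_space Y) ?T"
    by (simp add: open_set_space_def openin_scott_topology)
  then show "U \<subseteq> V"
    using specialization_leD[OF le, of ?T] assms by auto
next
  assume "U \<subseteq> V"
  then show "specialization_le (open_set_space Y) U V"
    using assms by (auto simp: specialization_le_def in_closure_of open_set_space_def
      openin_scott_topology scott_open_on_def)
qed

end

theory Submission
  imports Defs
begin

text \<open>
  Write \<open>\<nabla>K\<close> for the set of open neighbourhoods of \<open>K\<close>. A closed set \<open>\<A>\<close> of compact saturated
  sets is determined by the Scott-open family \<open>\<Union>K\<in>\<A>. \<nabla>K\<close>, and consonance says that every
  Scott-open family arises in this way. A compact saturated set \<open>\<K>\<close> of closed sets is determined
  by the family of open sets hitting every member of \<open>\<K>\<close>; conversely a Scott-open family \<open>H\<close>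
  yields the closed sets whose complement is not in \<open>H\<close>, a compact set by Alexander's subbase
  theorem. Both correspondences are order isomorphisms onto \<open>O(O(X))\<close>.

  Each of the three topologies lies between the weak and the Scott topology of its order, so it
  remains to see that the latter two agree on \<open>O(O(X))\<close>. Let \<open>\<U>\<close> be Scott open and \<open>H \<in> \<U>\<close>.
  By consonance there is a finite union \<open>\<nabla>K\<^sub>1 \<union> \<dots> \<union> \<nabla>K\<^sub>n \<in> \<U>\<close> contained in \<open>H\<close>. Let
  \<open>V\<^sub>i(m)\<close> be a decreasing neighbourhood base of \<open>K\<^sub>i\<close>. If there were \<open>G\<^sub>m \<notin> \<U>\<close> containing all
  \<open>V\<^sub>i(m)\<close>, then the families \<open>E\<^sub>m = (\<nabla>K\<^sub>1 \<union> \<dots> \<union> \<nabla>K\<^sub>n) \<inter> (\<Inter>k\<ge>m. G\<^sub>k)\<close> would be Scott open and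
  increase to \<open>\<nabla>K\<^sub>1 \<union> \<dots> \<union> \<nabla>K\<^sub>n\<close>, forcing \<open>E\<^sub>m \<in> \<U>\<close> and hence \<open>G\<^sub>m \<in> \<U>\<close> for some \<open>m\<close>.
\<close>

section \<open>Order isomorphisms and the weak and Scott topologies\<close>

definition order_iso_on ::
  "'a set \<Rightarrow> ('a \<Rightarrow> 'a \<Rightarrow> bool) \<Rightarrow> 'b set \<Rightarrow> ('b \<Rightarrow> 'b \<Rightarrow> bool) \<Rightarrow> ('a \<Rightarrow> 'b) \<Rightarrow> bool" where
  "order_iso_on P le Q le' f \<longleftrightarrow>
     bij_betw f P Q \<and> (\<forall>x\<in>P. \<forall>y\<in>P. le x y \<longleftrightarrow> le' (f x) (f y))"

lemma order_iso_onD: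
  assumes "order_iso_on P le Q le' f"
  shows "bij_betw f P Q"
    and "x \<in> P \<Longrightarrow> y \<in> P \<Longrightarrow> le x y \<longleftrightarrow> le' (f x) (f y)"
  using assms by (auto simp: order_iso_on_def)

lemma continuous_map_weak_topology:
  assumes iso: "order_iso_on P le Q le' f"
  shows "continuous_map (weak_topology P le) (weak_topology Q le') f"
  unfolding weak_topology_def[of Q]
proof (rule continuous_on_generated_topo)
  have PQ: "f ` P = Q"
    using order_iso_onD(1)[OF iso] by (simp add: bij_betw_def)
  fix U assume "U \<in> insert Q {{y \<in> Q. \<not> le' y x} |x. x \<in> Q}"
  then consider "U = Q" | x where "x \<in> P" "U = {y \<in> Q. \<not> le' y (f x)}"
    using PQ by blast
  then show "openin (weak_topology P le) (f -` U \<inter> topspace (weak_topology P le))"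
  proof cases
    case 1
    then have "f -` U \<inter> topspace (weak_topology P le) = topspace (weak_topology P le)"
      using PQ by auto
    then show ?thesis
      by (metis openin_topspace)
  next
    case 2
    then have "f -` U \<inter> topspace (weak_topology P le) = {y \<in> P. \<not> le y x}"
      using PQ order_iso_onD(2)[OF iso] by auto
    then show ?thesis
      using 2 by (auto simp: weak_topology_def intro!: topology_generated_by_Basis)
  qed
next
  show "f ` topspace (weak_topology P le) \<subseteq> \<Union> (insert Q {{y \<in> Q. \<not> le' y x} |x. x \<in> Q})"
    using order_iso_onD(1)[OF iso] by (auto simp: bij_betw_def)
qed

lemma continuous_map_scott_topology:
  assumes iso: "order_iso_on P le Q le' f"
  shows "continuous_map (scott_topology P le) (scott_topology Q le') f"
  unfolding continuous_map_alt
proof (intro conjI allI impI)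
  have PQ: "f ` P = Q"
    using order_iso_onD(1)[OF iso] by (simp add: bij_betw_def)
  then show "f \<in> topspace (scott_topology P le) \<rightarrow> topspace (scott_topology Q le')"
    by auto
  fix U assume "openin (scott_topology Q le') U"
  then have U: "scott_open_on Q le' U"
    by (simp add: openin_scott_topology)
  have "scott_open_on P le (f -` U \<inter> P)"
  proof (rule scott_open_onI)
    show "y \<in> f -` U \<inter> P" if "x \<in> f -` U \<inter> P" "y \<in> P" "le x y" for x y
      using that scott_open_onD(2)[OF U, of "f x" "f y"] PQ order_iso_onD(2)[OF iso, of x y] by auto
    fix D s
    assume D: "D \<subseteq> P" "directed_on le D" and sup: "is_sup_on P le D s" and s: "s \<in> f -` U \<inter> P"
    have "directed_on le' (f ` D)"
      using D order_iso_onD(2)[OF iso] unfolding directed_on_def by (auto simp: subset_iff)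
    moreover have "is_sup_on Q le' (f ` D) (f s)"
      using sup D(1) order_iso_onD(2)[OF iso] PQ unfolding is_sup_on_def by (auto simp: subset_iff)
    ultimately have "\<exists>d \<in> f ` D. d \<in> U"
      using s D(1) PQ by (intro scott_open_onD(3)[OF U]) auto
    then show "\<exists>d\<in>D. d \<in> f -` U \<inter> P"
      using D(1) by auto
  qed auto
  then show "openin (scott_topology P le) (f -` U \<inter> topspace (scott_topology P le))"
    by (simp add: openin_scott_topology)
qed

lemma order_iso_on_inv_into:
  assumes iso: "order_iso_on P le Q le' f"
  shows "order_iso_on Q le' P le (inv_into P f)"
proof -
  note f = order_iso_onD(1)[OF iso]
  have "le' x y \<longleftrightarrow> le (inv_into P f x) (inv_into P f y)" if "x \<in> Q" "y \<in> Q" for x y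
    using order_iso_onD(2)[OF iso, of "inv_into P f x" "inv_into P f y"] that
      bij_betw_inv_into_right[OF f] bij_betwE[OF bij_betw_inv_into[OF f]] by simp
  then show ?thesis
    using bij_betw_inv_into[OF f] by (simp add: order_iso_on_def)
qed

lemma homeomorphic_map_weak_topology:
  assumes iso: "order_iso_on P le Q le' f"
  shows "homeomorphic_map (weak_topology P le) (weak_topology Q le') f"
proof -
  have "homeomorphic_maps (weak_topology P le) (weak_topology Q le') f (inv_into P f)"
    unfolding homeomorphic_maps_def
    using continuous_map_weak_topology[OF iso]
      continuous_map_weak_topology[OF order_iso_on_inv_into[OF iso]]
    by (simp add: bij_betw_inv_into_left[OF order_iso_onD(1)[OF iso]]
      bij_betw_inv_into_right[OF order_iso_onD(1)[OF iso]])
  then show ?thesis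
    unfolding homeomorphic_map_maps by blast
qed

lemma homeomorphic_map_scott_topology:
  assumes iso: "order_iso_on P le Q le' f"
  shows "homeomorphic_map (scott_topology P le) (scott_topology Q le') f"
proof -
  have "homeomorphic_maps (scott_topology P le) (scott_topology Q le') f (inv_into P f)"
    unfolding homeomorphic_maps_def
    using continuous_map_scott_topology[OF iso]
      continuous_map_scott_topology[OF order_iso_on_inv_into[OF iso]]
    by (simp add: bij_betw_inv_into_left[OF order_iso_onD(1)[OF iso]]
      bij_betw_inv_into_right[OF order_iso_onD(1)[OF iso]])
  then show ?thesis
    unfolding homeomorphic_map_maps by blast
qed

text \<open>Both topologies depend on the order alone, so \<open>f\<close> is a homeomorphism for
  each of them. This carries the equality from \<open>O(O(X))\<close> over to the two
  powerspaces.\<close>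

lemma weak_eq_scott_order_iso:
  assumes iso: "order_iso_on P le Q le' f"
    and eq: "weak_topology Q le' = scott_topology Q le'"
  shows "weak_topology P le = scott_topology P le"
proof (rule topology_eq[THEN iffD2], intro allI)
  fix U
  show "openin (weak_topology P le) U \<longleftrightarrow> openin (scott_topology P le) U"
    using homeomorphic_map_openness_eq[OF homeomorphic_map_weak_topology[OF iso], of U]
      homeomorphic_map_openness_eq[OF homeomorphic_map_scott_topology[OF iso], of U] eq
    by simp
qed

text \<open>The set of points below \<open>x\<close> is the closure of \<open>{x}\<close>, so each
  generator of the weak topology has a closed complement: among topologies with this specialization
  order the weak one is coarsest.\<close>

lemma openin_weak_topology_specialization:
  assumes "openin (weak_topology (topspace Z) (specialization_le Z)) U"
  shows "openin Z U"
proof -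
  have "openin Z S"
    if S: "S \<in> insert (topspace Z) {{y \<in> topspace Z. \<not> specialization_le Z y x} |x. x \<in> topspace Z}"
    for S
  proof (cases "S = topspace Z")
    case False
    then obtain x where "S = topspace Z - Z closure_of {x}"
      using S by (auto simp: specialization_le_def)
    then show ?thesis
      by auto
  qed auto
  then show ?thesis
    using assms unfolding weak_topology_def openin_topology_generated_by_iff
    by (rule generate_topology_on_coarsest[OF istopology_openin])
qed

text \<open>A squeeze: \<open>Z\<close> always contains the weak topology, and by
  \<open>scott\<close> it is contained in the Scott topology.\<close>

lemma topology_eq_weak_scott:
  assumes scott: "\<And>U. openin Z U \<Longrightarrow> scott_open_on (topspace Z) (specialization_le Z) U"
    and eq: "weak_topology (topspace Z) (specialization_le Z)
      = scott_topology (topspace Z) (specialization_le Z)"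
  shows "Z = weak_topology (topspace Z) (specialization_le Z)"
    and "Z = scott_topology (topspace Z) (specialization_le Z)"
proof -
  show "Z = weak_topology (topspace Z) (specialization_le Z)"
    using openin_weak_topology_specialization[of Z] scott
    by (metis eq openin_scott_topology topology_eq)
  then show "Z = scott_topology (topspace Z) (specialization_le Z)"
    using eq by simp
qed

text \<open>For use with specialization orders, which are identified with inclusion only between
  points of the carrier.\<close>

lemma scott_open_on_cong:
  assumes "\<And>x y. x \<in> P \<Longrightarrow> y \<in> P \<Longrightarrow> le x y \<longleftrightarrow> le' x y"
  shows "scott_open_on P le U \<longleftrightarrow> scott_open_on P le' U"
proof -
  have *: "scott_open_on P le U"
    if eq: "\<And>x y. x \<in> P \<Longrightarrow> y \<in> P \<Longrightarrow> le x y \<longleftrightarrow> le' x y" and U: "scott_open_on P le' U" for le le'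
  proof (rule scott_open_onI)
    show "U \<subseteq> P"
      using U by (rule scott_open_onD)
    show "y \<in> U" if "x \<in> U" "y \<in> P" "le x y" for x y
      using that scott_open_onD(1)[OF U] scott_open_onD(2)[OF U, of x y] eq[of x y] by auto
    fix D s assume D: "D \<subseteq> P" "directed_on le D" and sup: "is_sup_on P le D s" and s: "s \<in> U"
    have "directed_on le' D"
      using D eq unfolding directed_on_def by (auto simp: subset_iff) 
    moreover have "is_sup_on P le' D s"
      using sup D(1) eq unfolding is_sup_on_def by (auto simp: subset_iff)
    ultimately show "\<exists>d\<in>D. d \<in> U"
      using scott_open_onD(3)[OF U D(1)] s by blast
  qed
  show ?thesis
    using *[of le le'] *[of le' le] assms by blast
qed

section \<open>Scott-open families of open sets\<close>

lemma directed_subset_finite_bound: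
  assumes D: "directed_on (\<subseteq>) D" and "finite F" "F \<subseteq> D"
  shows "\<exists>d\<in>D. \<Union>F \<subseteq> d"
  using assms(2,3)
proof (induction F)
  case empty
  then show ?case
    using D by (auto simp: directed_on_def)
next
  case (insert a F)
  then obtain d where "d \<in> D" "\<Union>F \<subseteq> d" "a \<in> D"
    by auto
  moreover obtain e where "e \<in> D" "a \<subseteq> e" "d \<subseteq> e"
    using D calculation unfolding directed_on_def by meson
  ultimately show ?case
    by auto
qed

lemma finite_subset_directed_Union:
  assumes D: "directed_on (\<subseteq>) D" and "finite G" "G \<subseteq> \<Union>D"
  shows "\<exists>d\<in>D. G \<subseteq> d"
proof -
  obtain F where F: "finite F" "F \<subseteq> D" "G \<subseteq> \<Union>F"
    using finite_subset_Union[OF assms(2,3)] by blast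
  obtain d where "d \<in> D" "\<Union>F \<subseteq> d"
    using directed_subset_finite_bound[OF D F(1,2)] by (rule bexE)
  with F(3) show ?thesis
    by blast
qed

lemma is_sup_on_openin:
  assumes "D \<subseteq> {U. openin Y U}"
  shows "is_sup_on {U. openin Y U} (\<subseteq>) D s \<longleftrightarrow> s = \<Union>D"
proof -
  have "openin Y (\<Union>D)"
    using assms by auto
  then show ?thesis
    unfolding is_sup_on_def using assms by auto
qed

lemma openin_open_set_space:
  "openin (open_set_space Y) H \<longleftrightarrow>
     H \<subseteq> {U. openin Y U} \<and>
     (\<forall>U V. U \<in> H \<and> openin Y V \<and> U \<subseteq> V \<longrightarrow> V \<in> H) \<and>
     (\<forall>D. D \<subseteq> {U. openin Y U} \<and> directed_on (\<subseteq>) D \<and> \<Union>D \<in> H \<longrightarrow> (\<exists>d\<in>D. d \<in> H))"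
  (is "?L \<longleftrightarrow> ?R")
proof
  assume ?L
  then have H: "scott_open_on {U. openin Y U} (\<subseteq>) H"
    by (simp add: open_set_space_def openin_scott_topology)
  show ?R
    using scott_open_onD[OF H] by (auto simp: is_sup_on_openin)
next
  assume R: ?R
  have "scott_open_on {U. openin Y U} (\<subseteq>) H"
  proof (rule scott_open_onI)
    fix D s
    assume D: "D \<subseteq> {U. openin Y U}" "directed_on (\<subseteq>) D"
      "is_sup_on {U. openin Y U} (\<subseteq>) D s" "s \<in> H"
    then have "\<Union>D \<in> H"
      by (simp add: is_sup_on_openin)
    then show "\<exists>d\<in>D. d \<in> H"
      using R D(1,2) by blast
  qed (use R in auto)
  then show ?L
    by (simp add: open_set_space_def openin_scott_topology)
qed

lemma openin_open_set_spaceI: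
  assumes "\<And>U. U \<in> H \<Longrightarrow> openin Y U"
    and "\<And>U V. U \<in> H \<Longrightarrow> openin Y V \<Longrightarrow> U \<subseteq> V \<Longrightarrow> V \<in> H"
    and "\<And>D. D \<subseteq> {U. openin Y U} \<Longrightarrow> directed_on (\<subseteq>) D \<Longrightarrow> \<Union>D \<in> H \<Longrightarrow> \<exists>d\<in>D. d \<in> H"
  shows "openin (open_set_space Y) H"
  unfolding openin_open_set_space using assms by blast

lemma openin_open_set_spaceD:
  assumes "openin (open_set_space Y) H"
  shows "U \<in> H \<Longrightarrow> openin Y U"
    and "U \<in> H \<Longrightarrow> openin Y V \<Longrightarrow> U \<subseteq> V \<Longrightarrow> V \<in> H"
    and "D \<subseteq> {U. openin Y U} \<Longrightarrow> directed_on (\<subseteq>) D \<Longrightarrow> \<Union>D \<in> H \<Longrightarrow> \<exists>d\<in>D. d \<in> H"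
  using assms unfolding openin_open_set_space by blast+

text \<open>The finite unions of members of \<open>C\<close> form a directed family with union
  \<open>\<Union>C\<close>, so Scott openness acts as a compactness principle. It is applied both to
  families of open sets of \<open>X\<close> and, one level up, to subsets of
  \<open>O(O(X))\<close>.\<close>

lemma open_set_space_finite_subunion:
  assumes H: "openin (open_set_space Y) H" and C: "C \<subseteq> {U. openin Y U}" "\<Union>C \<in> H"
  obtains F where "finite F" "F \<subseteq> C" "\<Union>F \<in> H"
proof -
  let ?D = "Union ` {F. finite F \<and> F \<subseteq> C}"
  have "directed_on (\<subseteq>) ?D"
    unfolding directed_on_def
  proof (intro conjI ballI)
    fix x y assume "x \<in> ?D" "y \<in> ?D"
    then obtain F G where "finite F" "F \<subseteq> C" "x = \<Union>F" "finite G" "G \<subseteq> C" "y = \<Union>G"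
      by blast
    then show "\<exists>z\<in>?D. x \<subseteq> z \<and> y \<subseteq> z"
      by (intro bexI[of _ "\<Union>(F \<union> G)"] conjI imageI) auto
  qed blast
  moreover have "?D \<subseteq> {U. openin Y U}"
    using C(1) by auto
  moreover have "\<Union>?D = \<Union>C"
  proof
    show "\<Union>C \<subseteq> \<Union>?D"
    proof
      fix x assume "x \<in> \<Union>C"
      then obtain c where "c \<in> C" "x \<in> c"
        by blast
      moreover have "c \<in> ?D"
        using \<open>c \<in> C\<close> by (intro image_eqI[of _ _ "{c}"]) simp_all
      ultimately show "x \<in> \<Union>?D"
        by (rule_tac UnionI)
    qed
  qed blast
  ultimately have "\<exists>d\<in>?D. d \<in> H"
    using openin_open_set_spaceD(3)[OF H] C(2) by metis
  then show thesis
    using that by blast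
qed

lemma openin_open_set_space_nbhds:
  assumes K: "compactin Y K"
  shows "openin (open_set_space Y) {V. openin Y V \<and> K \<subseteq> V}"
proof (rule openin_open_set_spaceI)
  fix D
  assume D: "D \<subseteq> {U. openin Y U}" "directed_on (\<subseteq>) D" "\<Union>D \<in> {V. openin Y V \<and> K \<subseteq> V}"
  then obtain F where F: "finite F" "F \<subseteq> D" "K \<subseteq> \<Union>F"
    using compactinD[OF K, of D] by (metis (no_types, lifting) mem_Collect_eq subsetD)
  obtain d where d: "d \<in> D" "\<Union>F \<subseteq> d"
    using directed_subset_finite_bound[OF D(2) F(1,2)] by (rule bexE)
  have "K \<subseteq> d"
    using F(3) d(2) by (rule order_trans)
  then show "\<exists>d\<in>D. d \<in> {V. openin Y V \<and> K \<subseteq> V}"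
    using D(1) d(1) by auto
qed auto

text \<open>These families are the points of \<open>O(O(X))\<close> at which generators of the weak
  topology are taken later.\<close>

lemma openin_open_set_space_not_subset:
  "openin (open_set_space Y) {V. openin Y V \<and> \<not> V \<subseteq> U}"
  by (rule openin_open_set_spaceI) auto

section \<open>Countable neighbourhood bases, and weak versus Scott topology on
  \<open>O(O(X))\<close>\<close>

lemma second_countable_compact_nbhd_base:
  assumes "second_countable X" and K: "compactin X K"
  obtains V :: "nat \<Rightarrow> 'a set"
  where "\<And>m. openin X (V m)" "\<And>m. K \<subseteq> V m" "decseq V"
    "\<And>U. openin X U \<Longrightarrow> K \<subseteq> U \<Longrightarrow> \<exists>m. V m \<subseteq> U"
proof -
  obtain B where B: "countable B" "\<forall>V\<in>B. openin X V"
    "\<forall>U x. openin X U \<and> x \<in> U \<longrightarrow> (\<exists>V\<in>B. x \<in> V \<and> V \<subseteq> U)"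
    using assms(1) unfolding second_countable_def by (elim exE conjE)
  \<comment> \<open>By compactness, any open set around \<open>K\<close> contains a finite union of
    basic sets still covering \<open>K\<close>; there are only countably many such unions.\<close>
  define N where "N = {W \<in> Union ` {F. finite F \<and> F \<subseteq> B}. K \<subseteq> W}"
  have "countable N"
    unfolding N_def by (intro countable_Collect countable_image countable_Collect_finite_subset B(1))
  have N: "\<exists>W\<in>N. W \<subseteq> U" if U: "openin X U" "K \<subseteq> U" for U
  proof -
    have "K \<subseteq> \<Union>{V\<in>B. V \<subseteq> U}"
      using B(3) U by fastforce
    then obtain F where "finite F" "F \<subseteq> {V\<in>B. V \<subseteq> U}" "K \<subseteq> \<Union>F"
      using compactinD[OF K, of "{V\<in>B. V \<subseteq> U}"] B(2)
      by (metis (no_types, lifting) mem_Collect_eq)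
    then show ?thesis
      unfolding N_def by (intro bexI[of _ "\<Union>F"]) auto
  qed
  have "N \<noteq> {}"
    using N[OF openin_topspace compactin_subset_topspace[OF K]] by blast
  have Nop: "openin X W \<and> K \<subseteq> W" if "W \<in> N" for W
    using that B(2) unfolding N_def by auto
  \<comment> \<open>If \<open>N\<close> is finite, the enumeration is padded with an arbitrary
    element of \<open>N\<close>, so nonemptiness keeps every index inside \<open>N\<close>.\<close>
  have rng: "from_nat_into N j \<in> N" for j
    using \<open>N \<noteq> {}\<close> by (rule from_nat_into)
  \<comment> \<open>Intersecting the first members of the enumeration makes the base
    decreasing.\<close>
  define V where "V m = (\<Inter>j\<le>m. from_nat_into N j)" for m
  show thesis
  proof (rule that[of V])
    show "openin X (V m)" for m
      unfolding V_def using Nop rng by (intro openin_Inter) auto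
    show "K \<subseteq> V m" for m
      unfolding V_def using Nop rng by blast
    show "decseq V"
      unfolding V_def decseq_def by (auto simp: Ball_def)
    fix U assume "openin X U" "K \<subseteq> U"
    then obtain W where "W \<in> N" "W \<subseteq> U"
      using N by blast
    then obtain j where "from_nat_into N j = W"
      using \<open>countable N\<close> from_nat_into_surj by metis
    then have "V j \<subseteq> U"
      using \<open>W \<subseteq> U\<close> unfolding V_def by blast
    then show "\<exists>m. V m \<subseteq> U" ..
  qed
qed


lemma consonantD:
  assumes "consonant X" "openin (open_set_space X) H" "U \<in> H"
  shows "\<exists>K. compactin X K \<and> saturatedin X K \<and> U \<in> {V. openin X V \<and> K \<subseteq> V} \<and>
    {V. openin X V \<and> K \<subseteq> V} \<subseteq> H"
  using assms(1)[unfolded consonant_def, rule_format, OF conjI[OF assms(2,3)]] by auto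

text \<open>Weak openness in elementary form: the families containing a fixed finite
  \<open>F\<close> form a weakly open set. Here \<open>F\<close> consists of one sufficiently small
  neighbourhood for each of finitely many compact sets; the countable base allows the failures to be
  listed as a sequence.\<close>

lemma consonant_scott_nbhd_finite:
  assumes sc: "second_countable X" and cons: "consonant X"
    and \<U>: "openin (open_set_space (open_set_space X)) \<U>" and "H \<in> \<U>"
  obtains F where "finite F" "F \<subseteq> H"
    "\<And>G. openin (open_set_space X) G \<Longrightarrow> F \<subseteq> G \<Longrightarrow> G \<in> \<U>"
proof -
  define nbhds where "nbhds K = {V. openin X V \<and> K \<subseteq> V}" for K
  define \<K> where "\<K> = {K. compactin X K \<and> nbhds K \<subseteq> H}"
  have H: "openin (open_set_space X) H"
    using openin_open_set_spaceD(1)[OF \<U> \<open>H \<in> \<U>\<close>] .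
  \<comment> \<open>Consonance provides the nontrivial inclusion. The union lies in
    \<open>\<U>\<close>, so finitely many of the neighbourhood families already have their union in
    \<open>\<U>\<close>.\<close>
  have "\<Union>(nbhds ` \<K>) = H"
  proof
    show "\<Union>(nbhds ` \<K>) \<subseteq> H"
      unfolding \<K>_def by blast
    show "H \<subseteq> \<Union>(nbhds ` \<K>)"
    proof
      fix U assume "U \<in> H"
      then obtain K where "compactin X K" "U \<in> nbhds K" "nbhds K \<subseteq> H"
        using consonantD[OF cons H] unfolding nbhds_def by metis
      then show "U \<in> \<Union>(nbhds ` \<K>)"
        unfolding \<K>_def by blast
    qed
  qed
  moreover have "nbhds ` \<K> \<subseteq> {G. openin (open_set_space X) G}"
    unfolding \<K>_def nbhds_def by (auto intro: openin_open_set_space_nbhds)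
  ultimately obtain S where S: "finite S" "S \<subseteq> nbhds ` \<K>" "\<Union>S \<in> \<U>"
    using open_set_space_finite_subunion[OF \<U>, of "nbhds ` \<K>"] \<open>H \<in> \<U>\<close> by metis
  then obtain L where L: "finite L" "L \<subseteq> \<K>" "S = nbhds ` L"
    using finite_subset_image by metis
  have "\<forall>K\<in>L. \<exists>V :: nat \<Rightarrow> 'a set. (\<forall>m. V m \<in> nbhds K) \<and> decseq V \<and>
      (\<forall>U \<in> nbhds K. \<exists>m. V m \<subseteq> U)"
  proof
    fix K assume "K \<in> L"
    then have "compactin X K"
      using L(2) unfolding \<K>_def by blast
    then obtain V :: "nat \<Rightarrow> 'a set" where "\<And>m. openin X (V m)" "\<And>m. K \<subseteq> V m" "decseq V"
      "\<And>U. openin X U \<Longrightarrow> K \<subseteq> U \<Longrightarrow> \<exists>m. V m \<subseteq> U"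
      using second_countable_compact_nbhd_base[OF sc] by metis
    then show "\<exists>V :: nat \<Rightarrow> 'a set. (\<forall>m. V m \<in> nbhds K) \<and> decseq V \<and>
        (\<forall>U \<in> nbhds K. \<exists>m. V m \<subseteq> U)"
      unfolding nbhds_def by (intro exI[of _ V]) auto
  qed
  from bchoice[OF this] obtain V :: "'a set \<Rightarrow> nat \<Rightarrow> 'a set"
    where "\<forall>K\<in>L. (\<forall>m. V K m \<in> nbhds K) \<and> decseq (V K) \<and> (\<forall>U \<in> nbhds K. \<exists>m. V K m \<subseteq> U)"
    by (rule exE)
  then have V: "\<And>K m. K \<in> L \<Longrightarrow> V K m \<in> nbhds K" "\<And>K. K \<in> L \<Longrightarrow> decseq (V K)"
      "\<And>K U. K \<in> L \<Longrightarrow> U \<in> nbhds K \<Longrightarrow> \<exists>m. V K m \<subseteq> U"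
    by simp_all
  \<comment> \<open>One index serves all \<open>K\<close> in \<open>L\<close>, so a failure at every
    \<open>m\<close> gives a single sequence of counterexamples.\<close>
  have "\<exists>m. \<forall>G. openin (open_set_space X) G \<and> (\<lambda>K. V K m) ` L \<subseteq> G \<longrightarrow> G \<in> \<U>"
  proof (rule ccontr)
    assume "\<not> ?thesis"
    then obtain G where G: "\<And>m. openin (open_set_space X) (G m)"
      "\<And>m. (\<lambda>K. V K m) ` L \<subseteq> G m" "\<And>m. G m \<notin> \<U>"
      by metis
    \<comment> \<open>An infinite intersection of Scott-open families need not be Scott open.
      Restricting to \<open>\<Union>S\<close> repairs this, because each of its members lies in all
      but finitely many \<open>G k\<close>.\<close>
    define E where "E m = {U \<in> \<Union>S. \<forall>k\<ge>m. U \<in> G k}" for m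
    \<comment> \<open>Once \<open>V K m \<subseteq> U\<close>, every later \<open>V K k\<close> also
      lies in \<open>U\<close>; since \<open>V K k\<close> belongs to \<open>G k\<close>, so does
      \<open>U\<close>.\<close>
    have ev: "\<exists>m. \<forall>k\<ge>m. U \<in> G k" if U: "U \<in> \<Union>S" for U
    proof -
      obtain K where K: "K \<in> L" "U \<in> nbhds K"
        using U L(3) by blast
      then obtain m where "V K m \<subseteq> U"
        using V(3) by blast
      then have "U \<in> G k" if "k \<ge> m" for k
        using decseqD[OF V(2)[OF K(1)] that] G(2)[of k] K
          openin_open_set_spaceD(2)[OF G(1), of "V K k" k U] unfolding nbhds_def by blast
      then show ?thesis by blast
    qed
    have Sop: "openin (open_set_space X) (\<Union>S)"
      using openin_open_set_spaceD(1)[OF \<U> S(3)] .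
    have Eop: "openin (open_set_space X) (E m)" for m
    proof (rule openin_open_set_spaceI)
      show "openin X U" if "U \<in> E m" for U
        using that openin_open_set_spaceD(1)[OF Sop] unfolding E_def by blast
      show "W \<in> E m" if "U \<in> E m" "openin X W" "U \<subseteq> W" for U W
        using that openin_open_set_spaceD(2)[OF Sop] openin_open_set_spaceD(2)[OF G(1)]
        unfolding E_def by blast
      fix D
      assume D: "D \<subseteq> {U. openin X U}" "directed_on (\<subseteq>) D" "\<Union>D \<in> E m"
      then obtain d where d: "d \<in> D" "d \<in> \<Union>S"
        using openin_open_set_spaceD(3)[OF Sop D(1,2)] unfolding E_def by blast
      obtain n where n: "\<forall>k\<ge>n. d \<in> G k"
        using ev[OF d(2)] by blast
      \<comment> \<open>Beyond \<open>n\<close> membership in \<open>G k\<close> is automatic, so only finitely many \<open>k\<close> impose a condition.\<close>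
      have "\<exists>e\<in>D. e \<in> G k" if "k \<ge> m" for k
        using openin_open_set_spaceD(3)[OF G(1) D(1,2)] D(3) that unfolding E_def by blast
      then obtain e where e: "\<And>k. k \<ge> m \<Longrightarrow> e k \<in> D \<and> e k \<in> G k"
        by metis
      have "insert d (e ` {m..n}) \<subseteq> D"
        using d(1) e by auto
      \<comment> \<open>The bound \<open>c\<close> lies in \<open>G k\<close> through
        \<open>e k\<close> for \<open>m \<le> k \<le> n\<close> and through \<open>d\<close> for
        larger \<open>k\<close>; it lies in \<open>\<Union>S\<close> through \<open>d\<close>. If
        \<open>n < m\<close>, the interval is empty and only \<open>d\<close> is used.\<close>
      then obtain c where c: "c \<in> D" "\<Union>(insert d (e ` {m..n})) \<subseteq> c"
        using directed_subset_finite_bound[OF D(2), of "insert d (e ` {m..n})"] by auto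
      have cop: "openin X c"
        using c(1) D(1) by blast
      have "c \<in> \<Union>S"
        using openin_open_set_spaceD(2)[OF Sop d(2) cop] c(2) by simp
      moreover have "c \<in> G k" if "k \<ge> m" for k
      proof (cases "k \<le> n")
        case True
        then have "e k \<subseteq> c"
          using c(2) that by (simp add: UN_subset_iff)
        then show ?thesis
          using openin_open_set_spaceD(2)[OF G(1) _ cop] e[OF that] by blast
      next
        case False
        then show ?thesis
          using openin_open_set_spaceD(2)[OF G(1) _ cop, of d k] c(2) n by auto
      qed
      ultimately show "\<exists>c\<in>D. c \<in> E m"
        using c(1) unfolding E_def by blast
    qed
    \<comment> \<open>The increasing sequence \<open>E\<close> has its union in \<open>\<U>\<close>,
      so some \<open>E m\<close> lies in \<open>\<U>\<close>, and with it the larger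
      \<open>G m\<close>, contrary to the choice of \<open>G\<close>.\<close>
    have "\<Union>(range E) = \<Union>S"
      using ev unfolding E_def by blast
    moreover have "directed_on (\<subseteq>) (range E)"
      unfolding directed_on_def
    proof (intro conjI ballI)
      fix x y assume "x \<in> range E" "y \<in> range E"
      then obtain i j where "x = E i" "y = E j"
        by blast
      then have "x \<subseteq> E (max i j)" "y \<subseteq> E (max i j)"
        by (auto simp: E_def)
      then show "\<exists>z\<in>range E. x \<subseteq> z \<and> y \<subseteq> z"
        by blast
    qed blast
    moreover have "range E \<subseteq> {U. openin (open_set_space X) U}"
      using Eop by auto
    ultimately obtain m where "E m \<in> \<U>"
      using openin_open_set_spaceD(3)[OF \<U>, of "range E"] S(3) by auto
    moreover have "E m \<subseteq> G m"
      unfolding E_def by blast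
    ultimately have "G m \<in> \<U>"
      using openin_open_set_spaceD(2)[OF \<U>] G(1) by blast
    then show False
      using G(3) by blast
  qed
  then obtain m where m: "\<And>G. openin (open_set_space X) G \<Longrightarrow> (\<lambda>K. V K m) ` L \<subseteq> G \<Longrightarrow> G \<in> \<U>"
    by blast
  show thesis
  proof (rule that[OF _ _ m])
    show "(\<lambda>K. V K m) ` L \<subseteq> H"
      using V(1) L(2) unfolding \<K>_def by blast
  qed (use L(1) in auto)
qed

lemma openin_open_set_space_weak:
  assumes "second_countable X" "consonant X"
    and \<U>: "openin (open_set_space (open_set_space X)) \<U>"
  defines "Z \<equiv> open_set_space (open_set_space X)"
  shows "openin (weak_topology (topspace Z) (specialization_le Z)) \<U>"
proof (subst openin_subopen, intro ballI)
  let ?W = "weak_topology (topspace Z) (specialization_le Z)"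
  fix H assume "H \<in> \<U>"
  then obtain F where F: "finite F" "F \<subseteq> H"
    "\<And>G. openin (open_set_space X) G \<Longrightarrow> F \<subseteq> G \<Longrightarrow> G \<in> \<U>"
    using consonant_scott_nbhd_finite[OF assms(1-3)] by metis
  have Hop: "openin (open_set_space X) H"
    using openin_open_set_spaceD(1)[OF \<U> \<open>H \<in> \<U>\<close>] .
  have gen: "openin ?W {G \<in> topspace Z. U \<in> G}" if U: "U \<in> F" for U
  proof -
    \<comment> \<open>The largest Scott-open family omitting \<open>U\<close>: an upward closed
      family with a member inside \<open>U\<close> would contain \<open>U\<close>. Hence not being
      below \<open>?M\<close> means containing \<open>U\<close>.\<close>
    let ?M = "{V. openin X V \<and> \<not> V \<subseteq> U}"
    have Uop: "openin X U"
      using U F(2) openin_open_set_spaceD(1)[OF Hop] by blast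
    have "\<not> specialization_le Z G ?M \<longleftrightarrow> U \<in> G" if "G \<in> topspace Z" for G
    proof -
      have G: "openin (open_set_space X) G"
        using that unfolding Z_def by simp
      have "specialization_le Z G ?M \<longleftrightarrow> G \<subseteq> ?M"
        unfolding Z_def by (rule specialization_le_open_set_space[OF G openin_open_set_space_not_subset])
      also have "\<dots> \<longleftrightarrow> U \<notin> G"
        using openin_open_set_spaceD(1,2)[OF G] Uop by blast
      finally show ?thesis by blast
    qed
    then have "{G \<in> topspace Z. U \<in> G} = {G \<in> topspace Z. \<not> specialization_le Z G ?M}"
      by blast
    moreover have "?M \<in> topspace Z"
      unfolding Z_def by (simp add: openin_open_set_space_not_subset)
    ultimately show ?thesis
      unfolding weak_topology_def by (intro topology_generated_by_Basis) blast
  qed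
  \<comment> \<open>Intersecting with the carrier covers the case \<open>F = {}\<close>, where the
    bare intersection would be the whole type.\<close>
  have "openin ?W (topspace Z \<inter> \<Inter>((\<lambda>U. {G \<in> topspace Z. U \<in> G}) ` F))"
    using F(1) gen openin_topspace[of ?W] by (intro openin_Int_Inter) auto
  moreover have "topspace Z \<inter> \<Inter>((\<lambda>U. {G \<in> topspace Z. U \<in> G}) ` F) \<subseteq> \<U>"
    using F(3) unfolding Z_def by auto
  moreover have "H \<in> topspace Z \<inter> \<Inter>((\<lambda>U. {G \<in> topspace Z. U \<in> G}) ` F)"
    using F(2) Hop unfolding Z_def by auto
  ultimately show "\<exists>T. openin ?W T \<and> H \<in> T \<and> T \<subseteq> \<U>"
    by blast
qed

lemma scott_open_on_specialization_open_set_space: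
  "scott_open_on (topspace (open_set_space Y)) (specialization_le (open_set_space Y)) U \<longleftrightarrow>
     openin (open_set_space Y) U"
proof -
  have "scott_open_on (topspace (open_set_space Y)) (specialization_le (open_set_space Y)) U
      \<longleftrightarrow> scott_open_on (topspace (open_set_space Y)) (\<subseteq>) U"
    by (rule scott_open_on_cong) (simp add: specialization_le_open_set_space)
  then show ?thesis
    by (simp add: open_set_space_def openin_scott_topology)
qed

lemma weak_eq_scott_open_set_space:
  assumes "second_countable X" "consonant X"
  defines "Z \<equiv> open_set_space (open_set_space X)"
  shows "weak_topology (topspace Z) (specialization_le Z)
    = scott_topology (topspace Z) (specialization_le Z)"
proof (rule topology_eq[THEN iffD2], intro allI)
  fix U
  show "openin (weak_topology (topspace Z) (specialization_le Z)) U
      \<longleftrightarrow> openin (scott_topology (topspace Z) (specialization_le Z)) U"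
    using openin_open_set_space_weak[OF assms(1,2), of U] openin_weak_topology_specialization[of Z U]
    unfolding Z_def openin_scott_topology scott_open_on_specialization_open_set_space by blast
qed


section \<open>The lower powerspace of the upper powerspace\<close>

text \<open>Scott-open sets form a topology, so generators suffice. If no member of \<open>D\<close>
  meets \<open>U\<close>, the closed set \<open>topspace Y - U\<close> is an upper bound of
  \<open>D\<close> and hence contains the supremum.\<close>

lemma scott_open_on_lower_powerspace:
  assumes "openin (lower_powerspace Y) W"
  shows "scott_open_on (topspace (lower_powerspace Y)) (specialization_le (lower_powerspace Y)) W"
proof -
  let ?P = "topspace (lower_powerspace Y)" and ?le = "specialization_le (lower_powerspace Y)"
  have "scott_open_on ?P ?le S"
    if S: "S \<in> insert {A. closedin Y A} {{A. closedin Y A \<and> A \<inter> U \<noteq> {}} |U. openin Y U}" for S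
  proof (cases "S = {A. closedin Y A}")
    case True
    then have "openin (scott_topology ?P ?le) S"
      using openin_topspace[of "scott_topology ?P ?le"] by simp
    then show ?thesis
      by (simp add: openin_scott_topology)
  next
    case False
    then obtain U where U: "openin Y U" and S: "S = {A. closedin Y A \<and> A \<inter> U \<noteq> {}}"
      using S by blast
    show ?thesis
      unfolding S
    proof (rule scott_open_onI)
      fix A B assume "A \<in> {A. closedin Y A \<and> A \<inter> U \<noteq> {}}" "B \<in> ?P" "?le A B"
      then show "B \<in> {A. closedin Y A \<and> A \<inter> U \<noteq> {}}"
        using specialization_le_lower_powerspace[of Y A B] by auto
    next
      fix D s
      assume D: "D \<subseteq> ?P" and sup: "is_sup_on ?P ?le D s"
        and s: "s \<in> {A. closedin Y A \<and> A \<inter> U \<noteq> {}}"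
      show "\<exists>d\<in>D. d \<in> {A. closedin Y A \<and> A \<inter> U \<noteq> {}}"
      proof (rule ccontr)
        assume none: "\<not> ?thesis"
        let ?C = "topspace Y - U"
        have C: "closedin Y ?C"
          using U by blast
        have "?le d ?C" if d: "d \<in> D" for d
        proof -
          have "closedin Y d"
            using d D by auto
          moreover have "d \<subseteq> ?C"
            using d none closedin_subset[OF calculation] calculation by blast
          ultimately show ?thesis
            using C by (simp add: specialization_le_lower_powerspace)
        qed
        then have "?le s ?C"
          using sup C by (simp add: is_sup_on_def)
        then have "s \<subseteq> ?C"
          using s C by (simp add: specialization_le_lower_powerspace)
        then show False
          using s by blast
      qed
    qed auto
  qed
  then show ?thesis
    using assms unfolding lower_powerspace_def[of Y] openin_topology_generated_by_iff
    unfolding lower_powerspace_def[of Y, symmetric]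
    by (rule generate_topology_on_coarsest[OF istopology_scott_open_on])
qed

text \<open>The sets \<open>box U\<close> are stable under finite intersection, hence form a base,
  and the closure can be tested on them alone.\<close>

lemma in_closure_of_upper_powerspace:
  assumes L: "compactin X L" "saturatedin X L"
    and meet: "\<And>U. openin X U \<Longrightarrow> L \<subseteq> U \<Longrightarrow> \<exists>K\<in>\<A>. compactin X K \<and> saturatedin X K \<and> K \<subseteq> U"
  shows "L \<in> upper_powerspace X closure_of \<A>"
proof -
  define box where "box U = {K. compactin X K \<and> saturatedin X K \<and> K \<subseteq> U}" for U
  have base: "L \<in> T \<Longrightarrow> \<exists>U. openin X U \<and> L \<subseteq> U \<and> box U \<subseteq> T"
    if "generate_topology_on {box U |U. openin X U} T" for T
    using that
  proof (induction rule: generate_topology_on.induct)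
    case (Int a b)
    then have "L \<in> a" "L \<in> b"
      by auto
    then obtain U V where "openin X U" "L \<subseteq> U" "box U \<subseteq> a" "openin X V" "L \<subseteq> V" "box V \<subseteq> b"
      using Int.IH by (elim meta_impE exE conjE)
    moreover have "box (U \<inter> V) \<subseteq> box U \<inter> box V"
      unfolding box_def by blast
    ultimately show ?case
      by (intro exI[of _ "U \<inter> V"]) auto
  next
    case (UN \<T>)
    then obtain T where T: "T \<in> \<T>" "L \<in> T"
      by blast
    obtain U where "openin X U" "L \<subseteq> U" "box U \<subseteq> T"
      using UN.IH[OF T] by (elim exE conjE)
    then show ?case
      using T(1) by (intro exI[of _ U]) auto
  next
    case (Basis s)
    then show ?case
      by (auto simp: box_def)
  qed auto
  show ?thesis
    unfolding in_closure_of
  proof (intro conjI allI impI)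
    show "L \<in> topspace (upper_powerspace X)"
      using L by simp
    fix T assume "L \<in> T \<and> openin (upper_powerspace X) T"
    then have T: "L \<in> T" "generate_topology_on {box U |U. openin X U} T"
      by (simp_all add: upper_powerspace_def box_def openin_topology_generated_by_iff)
    obtain U where U: "openin X U" "L \<subseteq> U" "box U \<subseteq> T"
      using base[OF T(2,1)] by (elim conjE exE)
    show "\<exists>y. y \<in> \<A> \<and> y \<in> T"
      using meet[OF U(1,2)] U(3) unfolding box_def by blast
  qed
qed

lemma order_iso_on_lower_upper_open_set_space:
  fixes X :: "'a topology"
  assumes cons: "consonant X"
  defines "Y \<equiv> lower_powerspace (upper_powerspace X)"
    and "Z \<equiv> open_set_space (open_set_space X)"
  shows "order_iso_on (topspace Y) (specialization_le Y) (topspace Z) (specialization_le Z)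
    (\<lambda>\<A>. {U. openin X U \<and> (\<exists>K\<in>\<A>. K \<subseteq> U)})"
proof -
  define f where "f \<A> = {U. openin X U \<and> (\<exists>K\<in>\<A>. K \<subseteq> U)}" for \<A> :: "'a set set"
  define nbhds where "nbhds K = {V. openin X V \<and> K \<subseteq> V}" for K
  define g where "g H = {K. compactin X K \<and> saturatedin X K \<and> nbhds K \<subseteq> H}" for H
  have Y: "topspace Y = {\<A>. closedin (upper_powerspace X) \<A>}"
    and Z: "topspace Z = {H. openin (open_set_space X) H}"
    by (simp_all add: Y_def Z_def)
  have AK: "compactin X K \<and> saturatedin X K" if "\<A> \<in> topspace Y" "K \<in> \<A>" for \<A> K
    using that closedin_subset[of "upper_powerspace X" \<A>] unfolding Y by auto
  have fZ: "f \<A> \<in> topspace Z" if \<A>: "\<A> \<in> topspace Y" for \<A>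
  proof -
    have "f \<A> = (\<Union>K\<in>\<A>. nbhds K)"
      unfolding f_def nbhds_def by blast
    moreover have "openin (open_set_space X) (nbhds K)" if "K \<in> \<A>" for K
      unfolding nbhds_def using AK[OF \<A> that] by (intro openin_open_set_space_nbhds) simp
    ultimately show ?thesis
      unfolding Z by auto
  qed
  have gY: "g H \<in> topspace Y" if "H \<in> topspace Z" for H
  proof -
    \<comment> \<open>A compact saturated \<open>K\<close> fails to be in \<open>g H\<close> exactly
      when some open \<open>U\<close> outside \<open>H\<close> contains it; so the complement is a
      union of generators.\<close>
    have "topspace (upper_powerspace X) - g H =
        \<Union>{{K. compactin X K \<and> saturatedin X K \<and> K \<subseteq> U} |U. openin X U \<and> U \<notin> H}"
      unfolding g_def nbhds_def by auto
    moreover have "openin (upper_powerspace X) \<dots>"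
      unfolding upper_powerspace_def by (intro openin_Union topology_generated_by_Basis) blast
    ultimately show ?thesis
      unfolding Y closedin_def by (auto simp: g_def)
  qed
  have gf: "g (f \<A>) = \<A>" if \<A>: "\<A> \<in> topspace Y" for \<A>
  proof
    show "\<A> \<subseteq> g (f \<A>)"
      using AK[OF \<A>] unfolding g_def f_def nbhds_def by blast
    show "g (f \<A>) \<subseteq> \<A>"
    proof
      fix L assume L: "L \<in> g (f \<A>)"
      \<comment> \<open>Membership in \<open>g (f \<A>)\<close> says that every open set around
        \<open>L\<close> contains a member of \<open>\<A>\<close>, which is adherence to the closed
        set \<open>\<A>\<close>.\<close>
      have "L \<in> upper_powerspace X closure_of \<A>"
      proof (rule in_closure_of_upper_powerspace)
        fix U assume "openin X U" "L \<subseteq> U"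
        then have "U \<in> f \<A>"
          using L unfolding g_def nbhds_def by blast
        then show "\<exists>K\<in>\<A>. compactin X K \<and> saturatedin X K \<and> K \<subseteq> U"
          using AK[OF \<A>] unfolding f_def by blast
      qed (use L in \<open>auto simp: g_def\<close>)
      then show "L \<in> \<A>"
        using \<A> unfolding Y by (simp add: closure_of_closedin)
    qed
  qed
  have fg: "f (g H) = H" if H: "H \<in> topspace Z" for H
  proof
    show "f (g H) \<subseteq> H"
      unfolding f_def g_def nbhds_def by blast
    show "H \<subseteq> f (g H)"
    proof
      fix U assume "U \<in> H"
      \<comment> \<open>Consonance is what makes \<open>f\<close> surjective.\<close>
      then obtain K where "compactin X K" "saturatedin X K" "U \<in> nbhds K" "nbhds K \<subseteq> H"
        using consonantD[OF cons, of H U] H unfolding Z nbhds_def by auto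
      then show "U \<in> f (g H)"
        unfolding f_def g_def nbhds_def by blast
    qed
  qed
  have "bij_betw f (topspace Y) (topspace Z)"
    by (rule bij_betw_byWitness[where f' = g]) (use fZ gY gf fg in auto)
  moreover have "specialization_le Y \<A> \<B> \<longleftrightarrow> specialization_le Z (f \<A>) (f \<B>)"
    if "\<A> \<in> topspace Y" "\<B> \<in> topspace Y" for \<A> \<B>
  proof -
    have "specialization_le Y \<A> \<B> \<longleftrightarrow> \<A> \<subseteq> \<B>"
      using that unfolding Y unfolding Y_def by (simp add: specialization_le_lower_powerspace)
    also have "\<dots> \<longleftrightarrow> f \<A> \<subseteq> f \<B>"
    proof
      show "f \<A> \<subseteq> f \<B>" if "\<A> \<subseteq> \<B>"
        using that unfolding f_def by blast
      assume "f \<A> \<subseteq> f \<B>"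
      then have "g (f \<A>) \<subseteq> g (f \<B>)"
        unfolding g_def by blast
      then show "\<A> \<subseteq> \<B>"
        using that gf by simp
    qed
    also have "\<dots> \<longleftrightarrow> specialization_le Z (f \<A>) (f \<B>)"
      using that fZ unfolding Z unfolding Z_def by (simp add: specialization_le_open_set_space)
    finally show ?thesis .
  qed
  ultimately show ?thesis
    unfolding order_iso_on_def f_def by blast
qed


section \<open>The upper powerspace of the lower powerspace\<close>

text \<open>Alexander's subbase theorem for a subset: it is applied to the topology \<open>T\<close>
  on \<open>S\<close> generated by the traces of \<open>\<B>\<close>. The inclusion of
  \<open>T\<close> into the generated topology is continuous, so its image \<open>S\<close> is
  compact.\<close>

lemma compactin_topology_generated_by:
  assumes "S \<subseteq> \<Union>\<B>"
    and "\<And>C. C \<subseteq> \<B> \<Longrightarrow> S \<subseteq> \<Union>C \<Longrightarrow> \<exists>C'. finite C' \<and> C' \<subseteq> C \<and> S \<subseteq> \<Union>C'"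
  shows "compactin (topology_generated_by \<B>) S"
proof -
  define T where "T = topology (arbitrary union_of (finite intersection_of (\<lambda>x. x \<in> \<B>) relative_to S))"
  have top: "topspace T = S"
    unfolding T_def by simp
  have "compact_space T"
    by (rule Alexander_subbase_alt[OF assms]) (simp_all add: T_def)
  moreover have "continuous_map T (topology_generated_by \<B>) id"
  proof (rule continuous_on_generated_topo)
    fix U assume "U \<in> \<B>"
    then have "openin T (S \<inter> U)"
      unfolding T_def openin_subbase
      by (intro arbitrary_union_of_inc relative_to_inc finite_intersection_of_inc)
    then show "openin T (id -` U \<inter> topspace T)"
      by (simp add: top Int_commute)
  qed (use assms(1) top in auto)
  ultimately show ?thesis
    using image_compactin[of T S _ id] by (simp add: compact_space_def top)
qed

lemma saturatedin_specialization:
  assumes "saturatedin Y K" "x \<in> K" "specialization_le Y x y"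
  shows "y \<in> K"
proof -
  have "y \<in> \<Inter>{U. openin Y U \<and> K \<subseteq> U}"
    using assms(2,3) specialization_leD by fastforce
  then show ?thesis
    using assms(1) unfolding saturatedin_def by simp
qed

text \<open>For finite sets \<open>F\<close> of open sets these are the finite intersections of the
  subbasic diamond sets. \<open>F = {}\<close> gives the whole carrier, and \<open>hit X {U}\<close>
  is a single diamond set.\<close>

definition hit :: "'a topology \<Rightarrow> 'a set set \<Rightarrow> 'a set set" where
  "hit X F = {A. closedin X A \<and> (\<forall>U\<in>F. A \<inter> U \<noteq> {})}"

lemma openin_lower_powerspace_hit:
  assumes "finite F" "\<And>U. U \<in> F \<Longrightarrow> openin X U"
  shows "openin (lower_powerspace X) (hit X F)"
proof -
  have "openin (lower_powerspace X) {A. closedin X A \<and> A \<inter> U \<noteq> {}}" if "U \<in> F" for U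
    unfolding lower_powerspace_def using assms(2)[OF that]
    by (intro topology_generated_by_Basis) blast
  then have "openin (lower_powerspace X)
      (topspace (lower_powerspace X) \<inter> \<Inter>((\<lambda>U. {A. closedin X A \<and> A \<inter> U \<noteq> {}}) ` F))"
    using assms(1) by (intro openin_Int_Inter openin_topspace) auto
  moreover have "topspace (lower_powerspace X) \<inter> \<Inter>((\<lambda>U. {A. closedin X A \<and> A \<inter> U \<noteq> {}}) ` F)
      = hit X F"
    unfolding hit_def by auto
  ultimately show ?thesis
    by simp
qed

lemma lower_powerspace_base:
  assumes "openin (lower_powerspace X) W" "A \<in> W"
  shows "\<exists>F. finite F \<and> (\<forall>U\<in>F. openin X U) \<and> A \<in> hit X F \<and> hit X F \<subseteq> W"
proof -
  have A: "closedin X A"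
    using openin_subset[OF assms(1)] assms(2) by auto
  have "generate_topology_on
      (insert {A. closedin X A} {{A. closedin X A \<and> A \<inter> U \<noteq> {}} |U. openin X U}) W"
    using assms(1) by (simp add: lower_powerspace_def openin_topology_generated_by_iff)
  then show ?thesis
    using assms(2)
  proof (induction rule: generate_topology_on.induct)
    case (Int a b)
    then have "A \<in> a" "A \<in> b"
      by auto
    then obtain F G where "finite F" "\<forall>U\<in>F. openin X U" "A \<in> hit X F" "hit X F \<subseteq> a"
      "finite G" "\<forall>U\<in>G. openin X U" "A \<in> hit X G" "hit X G \<subseteq> b"
      using Int.IH by (elim meta_impE exE conjE)
    moreover have "hit X (F \<union> G) = hit X F \<inter> hit X G"
      unfolding hit_def by blast
    ultimately show ?case
      by (intro exI[of _ "F \<union> G"]) auto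
  next
    case (UN \<T>)
    then obtain T where T: "T \<in> \<T>" "A \<in> T"
      by blast
    obtain F where "finite F" "\<forall>U\<in>F. openin X U" "A \<in> hit X F" "hit X F \<subseteq> T"
      using UN.IH[OF T] by (elim exE conjE)
    then show ?case
      using T(1) by (intro exI[of _ F]) auto
  next
    case (Basis s)
    then consider "s = {A. closedin X A}"
      | U where "openin X U" "s = {A. closedin X A \<and> A \<inter> U \<noteq> {}}"
      by blast
    then show ?case
    proof cases
      case 1
      then show ?thesis
        using A by (intro exI[of _ "{}"]) (auto simp: hit_def)
    next
      case 2
      then show ?thesis
        using A Basis.prems by (intro exI[of _ "{U}"]) (auto simp: hit_def)
    qed
  qed auto
qed

text \<open>Shrinking \<open>W\<close> to a single \<open>hit X G\<close> reduces inclusion in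
  \<open>W\<close> to finitely many conditions, namely that the members of \<open>G\<close> meet
  every set in \<open>\<K>\<close>. This finiteness drives the Scott openness of generators of
  \<open>K(A(X))\<close>.\<close>

lemma compact_lower_powerspace_nbhd:
  assumes \<K>: "compactin (lower_powerspace X) \<K>"
    and W: "openin (lower_powerspace X) W" "\<K> \<subseteq> W"
  obtains G where "finite G" "\<And>U. U \<in> G \<Longrightarrow> openin X U" "\<K> \<subseteq> hit X G" "hit X G \<subseteq> W"
proof -
  define \<F> where "\<F> = {F. finite F \<and> (\<forall>U\<in>F. openin X U) \<and> hit X F \<subseteq> W}"
  have "\<K> \<subseteq> \<Union>(hit X ` \<F>)"
  proof
    fix A assume "A \<in> \<K>"
    then obtain F where "F \<in> \<F>" "A \<in> hit X F"
      using lower_powerspace_base[OF W(1), of A] W(2) unfolding \<F>_def by auto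
    then show "A \<in> \<Union>(hit X ` \<F>)"
      by blast
  qed
  moreover have "openin (lower_powerspace X) S" if "S \<in> hit X ` \<F>" for S
    using that openin_lower_powerspace_hit unfolding \<F>_def by auto
  ultimately obtain C where C: "finite C" "C \<subseteq> hit X ` \<F>" "\<K> \<subseteq> \<Union>C"
    using compactinD[OF \<K>, of "hit X ` \<F>"] by metis
  then obtain \<E> where \<E>: "finite \<E>" "\<E> \<subseteq> \<F>" "C = hit X ` \<E>"
    using finite_subset_image by metis
  \<comment> \<open>Distributivity: a union of intersections of hit sets is an intersection over all
    transversals of unions, and a union of hit sets is the hit set of the union.\<close>
  define G where "G = Union ` {T. T \<subseteq> \<Union>\<E> \<and> (\<forall>F\<in>\<E>. T \<inter> F \<noteq> {})}"
  have \<E>op: "openin X U" if "U \<in> \<Union>\<E>" for U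
    using that \<E>(2) unfolding \<F>_def by auto
  show thesis
  proof (rule that)
    have "finite (\<Union>\<E>)"
      using \<E>(1,2) unfolding \<F>_def by auto
    then show "finite G"
      unfolding G_def by (intro finite_imageI) (auto intro: finite_subset[of _ "Pow (\<Union>\<E>)"])
    show "openin X U" if U: "U \<in> G" for U
    proof -
      obtain T where "T \<subseteq> \<Union>\<E>" "U = \<Union>T"
        using U unfolding G_def by blast
      then show ?thesis
        using \<E>op by (auto simp: subset_iff)
    qed
    show "\<K> \<subseteq> hit X G"
    proof
      fix A assume "A \<in> \<K>"
      then obtain F where F: "F \<in> \<E>" "A \<in> hit X F"
        using C(3) \<E>(3) by blast
      have "A \<inter> \<Union>T \<noteq> {}" if "T \<inter> F \<noteq> {}" for T
        using F(2) that unfolding hit_def by blast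
      then show "A \<in> hit X G"
        using F unfolding G_def hit_def by auto
    qed
    show "hit X G \<subseteq> W"
    proof
      fix A assume A: "A \<in> hit X G"
      \<comment> \<open>The union of all sets missed by \<open>A\<close> is itself missed, so
        \<open>T\<close> cannot be a transversal. Some \<open>F\<close> in \<open>\<E>\<close> is
        therefore disjoint from \<open>T\<close>, which means that \<open>A\<close> meets every
        member of \<open>F\<close>.\<close>
      define T where "T = {U \<in> \<Union>\<E>. A \<inter> U = {}}"
      have "A \<inter> \<Union>T = {}"
        unfolding T_def by auto
      then have "\<Union>T \<notin> G"
        using A by (auto simp: hit_def)
      then have "T \<notin> {T. T \<subseteq> \<Union>\<E> \<and> (\<forall>F\<in>\<E>. T \<inter> F \<noteq> {})}"
        unfolding G_def by (rule contrapos_nn) (rule imageI)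
      moreover have "T \<subseteq> \<Union>\<E>"
        unfolding T_def by (rule Collect_restrict)
      ultimately obtain F where "F \<in> \<E>" "T \<inter> F = {}"
        by auto
      then have "A \<in> hit X F"
        using A unfolding hit_def T_def by blast
      then show "A \<in> W"
        using \<open>F \<in> \<E>\<close> \<E>(2) unfolding \<F>_def by blast
    qed
  qed
qed

section \<open>The correspondence between \<open>K(A(X))\<close> and Scott-open families\<close>

definition hitting_opens :: "'a topology \<Rightarrow> 'a set set \<Rightarrow> 'a set set" where
  "hitting_opens X \<K> = {U. openin X U \<and> (\<forall>A\<in>\<K>. A \<inter> U \<noteq> {})}"

definition complement_not_in :: "'a topology \<Rightarrow> 'a set set \<Rightarrow> 'a set set" where
  "complement_not_in X H = {A. closedin X A \<and> topspace X - A \<notin> H}"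

text \<open>If \<open>\<Union>D\<close> meets every \<open>A\<close> in \<open>\<K>\<close>, the
  sets \<open>hit X {U}\<close> with \<open>U \<in> D\<close> cover \<open>\<K>\<close>. A finite
  subcover and directedness give one member of \<open>D\<close> meeting every
  \<open>A\<close>.\<close>

lemma openin_hitting_opens:
  assumes \<K>: "compactin (lower_powerspace X) \<K>"
  shows "openin (open_set_space X) (hitting_opens X \<K>)"
proof (rule openin_open_set_spaceI)
  fix D
  assume D: "D \<subseteq> {U. openin X U}" "directed_on (\<subseteq>) D" "\<Union>D \<in> hitting_opens X \<K>"
  have cl: "closedin X A" if "A \<in> \<K>" for A
    using compactin_subset_topspace[OF \<K>] that by auto
  have "\<K> \<subseteq> \<Union>((\<lambda>U. hit X {U}) ` D)"
  proof
    fix A assume A: "A \<in> \<K>"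
    then obtain U where "U \<in> D" "A \<inter> U \<noteq> {}"
      using D(3) unfolding hitting_opens_def by blast
    then show "A \<in> \<Union>((\<lambda>U. hit X {U}) ` D)"
      using cl[OF A] by (auto simp: hit_def)
  qed
  moreover have "openin (lower_powerspace X) S" if "S \<in> (\<lambda>U. hit X {U}) ` D" for S
    using that D(1) openin_lower_powerspace_hit[of "{_}" X] by auto
  ultimately obtain C where C: "finite C" "C \<subseteq> (\<lambda>U. hit X {U}) ` D" "\<K> \<subseteq> \<Union>C"
    using compactinD[OF \<K>, of "(\<lambda>U. hit X {U}) ` D"] by metis
  then obtain F where F: "finite F" "F \<subseteq> D" "C = (\<lambda>U. hit X {U}) ` F"
    using finite_subset_image by metis
  obtain d where d: "d \<in> D" "\<Union>F \<subseteq> d"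
    using directed_subset_finite_bound[OF D(2) F(1,2)] by (rule bexE)
  have "A \<inter> d \<noteq> {}" if A: "A \<in> \<K>" for A
  proof -
    obtain U where "U \<in> F" "A \<inter> U \<noteq> {}"
      using subsetD[OF C(3) A] F(3) unfolding hit_def by auto
    then show ?thesis
      using d(2) by blast
  qed
  then have "d \<in> hitting_opens X \<K>"
    using d(1) D(1) unfolding hitting_opens_def by auto
  then show "\<exists>d\<in>D. d \<in> hitting_opens X \<K>"
    using d(1) by blast
qed (auto simp: hitting_opens_def)

text \<open>If \<open>A\<close> missed \<open>U\<close>, the complement of \<open>A\<close> would
  contain \<open>U\<close> and so belong to the upward closed \<open>H\<close>.\<close>

lemma complement_not_in_hit:
  assumes H: "openin (open_set_space X) H" and "U \<in> H" "A \<in> complement_not_in X H"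
  shows "A \<inter> U \<noteq> {}"
proof
  assume "A \<inter> U = {}"
  moreover have "openin X U"
    using openin_open_set_spaceD(1)[OF H] assms(2) .
  ultimately have "U \<subseteq> topspace X - A"
    using openin_subset by blast
  moreover have A: "closedin X A" "topspace X - A \<notin> H"
    using assms(3) by (auto simp: complement_not_in_def)
  ultimately show False
    using openin_open_set_spaceD(2)[OF H assms(2)] by blast
qed

lemma compactin_complement_not_in:
  assumes H: "openin (open_set_space X) H"
  shows "compactin (lower_powerspace X) (complement_not_in X H)"
  unfolding lower_powerspace_def
proof (rule compactin_topology_generated_by)
  let ?top = "{A. closedin X A}"
  let ?\<B> = "insert ?top {{A. closedin X A \<and> A \<inter> U \<noteq> {}} |U. openin X U}"
  let ?S = "complement_not_in X H"
  show "?S \<subseteq> \<Union>?\<B>"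
    by (auto simp: complement_not_in_def)
  fix C assume C: "C \<subseteq> ?\<B>" "?S \<subseteq> \<Union>C"
  show "\<exists>C'. finite C' \<and> C' \<subseteq> C \<and> ?S \<subseteq> \<Union>C'"
  \<comment> \<open>The carrier is itself a generator; a cover using it has a one-element
    subcover.\<close>
  proof (cases "?top \<in> C")
    case True
    then show ?thesis
      by (intro exI[of _ "{?top}"]) (auto simp: complement_not_in_def)
  next
    case False
    define \<V> where "\<V> = {U. openin X U \<and> hit X {U} \<in> C}"
    have Ceq: "S \<in> (\<lambda>U. hit X {U}) ` \<V>" if S: "S \<in> C" for S
    proof -
      obtain U where "openin X U" "S = hit X {U}"
        using S C(1) False unfolding hit_def by blast
      then show ?thesis
        using S unfolding \<V>_def by blast
    qed
    let ?A = "topspace X - \<Union>\<V>"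
    have op: "openin X (\<Union>\<V>)"
      unfolding \<V>_def by auto
    \<comment> \<open>Otherwise the complement of \<open>\<Union>\<V>\<close> would belong to
      \<open>?S\<close> without meeting any member of \<open>\<V>\<close>. A finite subunion in
      \<open>H\<close> then meets every member of \<open>?S\<close>, which yields the finite
      subcover.\<close>
    have "\<Union>\<V> \<in> H"
    proof (rule ccontr)
      assume "\<Union>\<V> \<notin> H"
      moreover have "topspace X - ?A = \<Union>\<V>"
        using openin_subset[OF op] by blast
      ultimately have "?A \<in> ?S"
        using op unfolding complement_not_in_def by auto
      then obtain U where "U \<in> \<V>" "?A \<in> hit X {U}"
        using C(2) Ceq by blast
      then show False
        unfolding hit_def by blast
    qed
    moreover have "\<V> \<subseteq> {U. openin X U}"
      unfolding \<V>_def by blast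
    ultimately obtain F where F: "finite F" "F \<subseteq> \<V>" "\<Union>F \<in> H"
      using open_set_space_finite_subunion[OF H] by metis
    have "?S \<subseteq> \<Union>((\<lambda>U. hit X {U}) ` F)"
    proof
      fix A assume A: "A \<in> ?S"
      then obtain U where "U \<in> F" "A \<inter> U \<noteq> {}"
        using complement_not_in_hit[OF H F(3) A] by blast
      moreover have "closedin X A"
        using A by (simp add: complement_not_in_def)
      ultimately show "A \<in> \<Union>((\<lambda>U. hit X {U}) ` F)"
        by (auto simp: hit_def)
    qed
    moreover have "(\<lambda>U. hit X {U}) ` F \<subseteq> C"
      using F(2) unfolding \<V>_def by blast
    ultimately show ?thesis
      using F(1) by blast
  qed
qed

text \<open>If the complement of a closed \<open>A\<close> is in \<open>H\<close>, then the sets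
  meeting that complement form an open neighbourhood of the family which omits
  \<open>A\<close>.\<close>

lemma saturatedin_complement_not_in:
  assumes H: "openin (open_set_space X) H"
  shows "saturatedin (lower_powerspace X) (complement_not_in X H)"
  unfolding saturatedin_def
proof
  let ?S = "complement_not_in X H"
  show "\<Inter>{U. openin (lower_powerspace X) U \<and> ?S \<subseteq> U} \<subseteq> ?S"
  proof
    fix A assume A: "A \<in> \<Inter>{U. openin (lower_powerspace X) U \<and> ?S \<subseteq> U}"
    have "openin (lower_powerspace X) (topspace (lower_powerspace X))"
      by (rule openin_topspace)
    moreover have "?S \<subseteq> topspace (lower_powerspace X)"
      by (auto simp: complement_not_in_def)
    ultimately have cl: "closedin X A"
      using A by auto
    have "topspace X - A \<notin> H"
    proof
      assume "topspace X - A \<in> H"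
      then have "?S \<subseteq> hit X {topspace X - A}"
        using complement_not_in_hit[OF H] by (auto simp: hit_def complement_not_in_def)
      moreover have "openin (lower_powerspace X) (hit X {topspace X - A})"
        using cl by (intro openin_lower_powerspace_hit) auto
      ultimately have "A \<in> hit X {topspace X - A}"
        using A by blast
      then show False
        by (auto simp: hit_def)
    qed
    then show "A \<in> ?S"
      using cl by (simp add: complement_not_in_def)
  qed
qed blast

text \<open>The complement of \<open>A\<close> fails to hit some \<open>B\<close> in
  \<open>\<K>\<close> exactly when \<open>B \<subseteq> A\<close>, and a saturated
  \<open>\<K>\<close> is closed under passing to larger closed sets.\<close>

lemma complement_not_in_hitting_opens:
  assumes \<K>: "compactin (lower_powerspace X) \<K>" "saturatedin (lower_powerspace X) \<K>"
  shows "complement_not_in X (hitting_opens X \<K>) = \<K>"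
proof -
  have cl: "closedin X A" if "A \<in> \<K>" for A
    using compactin_subset_topspace[OF \<K>(1)] that by auto
  have "A \<in> complement_not_in X (hitting_opens X \<K>) \<longleftrightarrow> A \<in> \<K>" if A: "closedin X A" for A
  proof -
    have "A \<in> complement_not_in X (hitting_opens X \<K>) \<longleftrightarrow> (\<exists>B\<in>\<K>. B \<inter> (topspace X - A) = {})"
      using A by (auto simp: complement_not_in_def hitting_opens_def)
    also have "\<dots> \<longleftrightarrow> (\<exists>B\<in>\<K>. B \<subseteq> A)"
      using cl closedin_subset by blast
    also have "\<dots> \<longleftrightarrow> A \<in> \<K>"
      using saturatedin_specialization[OF \<K>(2)] specialization_le_lower_powerspace[OF _ A] cl
      by blast
    finally show ?thesis .
  qed
  moreover have "closedin X A" if "A \<in> complement_not_in X (hitting_opens X \<K>)" for A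
    using that by (simp add: complement_not_in_def)
  ultimately show ?thesis
    using cl by blast
qed

lemma hitting_opens_complement_not_in:
  assumes H: "openin (open_set_space X) H"
  shows "hitting_opens X (complement_not_in X H) = H"
proof
  show "H \<subseteq> hitting_opens X (complement_not_in X H)"
    using complement_not_in_hit[OF H] openin_open_set_spaceD(1)[OF H]
    by (auto simp: hitting_opens_def)
  show "hitting_opens X (complement_not_in X H) \<subseteq> H"
  proof
    fix U assume U: "U \<in> hitting_opens X (complement_not_in X H)"
    then have op: "openin X U"
      by (simp add: hitting_opens_def)
    have "topspace X - U \<notin> complement_not_in X H"
      using U unfolding hitting_opens_def by blast
    moreover have "topspace X - (topspace X - U) = U"
      using openin_subset[OF op] by blast
    ultimately show "U \<in> H"
      using op by (auto simp: complement_not_in_def)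
  qed
qed

lemma hitting_opens_subset_iff:
  assumes "compactin (lower_powerspace X) \<K>" "saturatedin (lower_powerspace X) \<K>"
    and "compactin (lower_powerspace X) \<L>" "saturatedin (lower_powerspace X) \<L>"
  shows "hitting_opens X \<K> \<subseteq> hitting_opens X \<L> \<longleftrightarrow> \<L> \<subseteq> \<K>"
proof
  assume "hitting_opens X \<K> \<subseteq> hitting_opens X \<L>"
  then have "complement_not_in X (hitting_opens X \<L>) \<subseteq> complement_not_in X (hitting_opens X \<K>)"
    by (auto simp: complement_not_in_def)
  then show "\<L> \<subseteq> \<K>"
    using assms by (simp add: complement_not_in_hitting_opens)
qed (auto simp: hitting_opens_def)

text \<open>Reverse inclusion turns into inclusion because a smaller set of closed sets is hit by
  more open sets.\<close>

lemma order_iso_on_upper_lower_open_set_space: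
  fixes X :: "'a topology"
  defines "Y \<equiv> upper_powerspace (lower_powerspace X)"
    and "Z \<equiv> open_set_space (open_set_space X)"
  shows "order_iso_on (topspace Y) (specialization_le Y) (topspace Z) (specialization_le Z)
    (hitting_opens X)"
  unfolding order_iso_on_def
proof (intro conjI ballI)
  show "bij_betw (hitting_opens X) (topspace Y) (topspace Z)"
    by (rule bij_betw_byWitness[where f' = "complement_not_in X"])
      (auto simp: Y_def Z_def openin_hitting_opens compactin_complement_not_in
        saturatedin_complement_not_in complement_not_in_hitting_opens hitting_opens_complement_not_in)
  fix \<K> \<L> assume "\<K> \<in> topspace Y" "\<L> \<in> topspace Y"
  then show "specialization_le Y \<K> \<L> \<longleftrightarrow> specialization_le Z (hitting_opens X \<K>) (hitting_opens X \<L>)"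
    by (simp add: Y_def Z_def specialization_le_upper_powerspace specialization_le_open_set_space
        openin_hitting_opens hitting_opens_subset_iff)
qed

text \<open>The supremum of a directed \<open>D\<close> is controlled through
  \<open>O(O(X))\<close>: the families of the members of \<open>D\<close> have a directed union, and
  a finite \<open>G\<close> contained in that union is contained in the family of a single
  member.\<close>

lemma scott_open_on_upper_lower_powerspace:
  fixes X :: "'a topology"
  defines "Y \<equiv> upper_powerspace (lower_powerspace X)"
  assumes "openin Y T"
  shows "scott_open_on (topspace Y) (specialization_le Y) T"
proof -
  let ?K = "{\<K>. compactin (lower_powerspace X) \<K> \<and> saturatedin (lower_powerspace X) \<K>}"
  have Y: "topspace Y = ?K"
    by (simp add: Y_def)
  have le: "specialization_le Y \<K> \<L> \<longleftrightarrow> \<L> \<subseteq> \<K>" if "\<K> \<in> ?K" "\<L> \<in> ?K" for \<K> \<L>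
    using that by (simp add: Y_def specialization_le_upper_powerspace)
  have "scott_open_on (topspace Y) (specialization_le Y) S"
    if S: "S \<in> {{\<K>. compactin (lower_powerspace X) \<K> \<and> saturatedin (lower_powerspace X) \<K> \<and> \<K> \<subseteq> W}
      |W. openin (lower_powerspace X) W}" for S
  proof -
    obtain W where W: "openin (lower_powerspace X) W"
      and "S = {\<K>. compactin (lower_powerspace X) \<K> \<and> saturatedin (lower_powerspace X) \<K> \<and> \<K> \<subseteq> W}"
      using S by blast
    then have S: "S = {\<K> \<in> ?K. \<K> \<subseteq> W}"
      by auto
    show ?thesis
    proof (rule scott_open_onI)
      show "S \<subseteq> topspace Y"
        using S Y by auto
      show "\<L> \<in> S" if "\<K> \<in> S" "\<L> \<in> topspace Y" "specialization_le Y \<K> \<L>" for \<K> \<L>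
        using that le[of \<K> \<L>] unfolding Y S by auto
      fix D s
      assume D: "D \<subseteq> topspace Y" "directed_on (specialization_le Y) D"
        and sup: "is_sup_on (topspace Y) (specialization_le Y) D s" and "s \<in> S"
      then have s: "s \<in> ?K" "s \<subseteq> W"
        using S by auto
      obtain G where G: "finite G" "\<And>U. U \<in> G \<Longrightarrow> openin X U" "s \<subseteq> hit X G" "hit X G \<subseteq> W"
        using compact_lower_powerspace_nbhd[OF _ W s(2)] s(1) by auto
      let ?\<D> = "hitting_opens X ` D" and ?H = "\<Union>(hitting_opens X ` D)"
      have DK: "d \<in> ?K" if "d \<in> D" for d
        using that D(1) Y by auto
      have H: "openin (open_set_space X) ?H"
        using DK by (intro openin_Union) (auto intro: openin_hitting_opens)
      \<comment> \<open>Pulling the union \<open>?H\<close> back to \<open>K(A(X))\<close> gives an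
        upper bound of \<open>D\<close>. The supremum \<open>s\<close> is below it, whence
        \<open>hitting_opens X s \<subseteq> ?H\<close>.\<close>
      let ?C = "complement_not_in X ?H"
      have C: "?C \<in> ?K"
        using compactin_complement_not_in[OF H] saturatedin_complement_not_in[OF H] by simp
      have "specialization_le Y d ?C" if d: "d \<in> D" for d
      proof -
        have "?C \<subseteq> complement_not_in X (hitting_opens X d)"
          using d by (auto simp: complement_not_in_def)
        also have "\<dots> = d"
          using DK[OF d] by (simp add: complement_not_in_hitting_opens)
        finally show ?thesis
          using le[OF DK[OF d] C] by simp
      qed
      then have "specialization_le Y s ?C"
        using sup C unfolding is_sup_on_def Y by blast
      then have "?C \<subseteq> s"
        using le[OF s(1) C] by simp
      then have "hitting_opens X s \<subseteq> hitting_opens X ?C"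
        by (auto simp: hitting_opens_def)
      also have "\<dots> = ?H"
        by (rule hitting_opens_complement_not_in[OF H])
      finally have "hitting_opens X s \<subseteq> ?H" .
      moreover have "G \<subseteq> hitting_opens X s"
        using G(2,3) by (auto simp: hitting_opens_def hit_def)
      ultimately have "G \<subseteq> ?H"
        by (rule order_trans[rotated])
      moreover have "directed_on (\<subseteq>) ?\<D>"
        unfolding directed_on_def
      proof (intro conjI ballI)
        show "?\<D> \<noteq> {}"
          using D(2) by (simp add: directed_on_def)
        fix x y assume "x \<in> ?\<D>" "y \<in> ?\<D>"
        then obtain a b where ab: "a \<in> D" "b \<in> D" "x = hitting_opens X a" "y = hitting_opens X b"
          by blast
        obtain c where c: "c \<in> D" "specialization_le Y a c" "specialization_le Y b c"
          using D(2) ab(1,2) unfolding directed_on_def by meson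
        then have "c \<subseteq> a" "c \<subseteq> b"
          using le DK ab(1,2) by simp_all
        then show "\<exists>z\<in>?\<D>. x \<subseteq> z \<and> y \<subseteq> z"
          using c(1) ab(3,4) by (intro bexI[of _ "hitting_opens X c"]) (auto simp: hitting_opens_def)
      qed
      ultimately obtain d where d: "d \<in> D" "G \<subseteq> hitting_opens X d"
        using finite_subset_directed_Union[OF _ G(1), of ?\<D>] by auto
      have "closedin X A" if "A \<in> d" for A
        using DK[OF d(1)] compactin_subset_topspace[of "lower_powerspace X" d] that by auto
      then have "d \<subseteq> hit X G"
        using d(2) by (auto simp: hit_def hitting_opens_def)
      then have "d \<in> S"
        using G(4) DK[OF d(1)] unfolding S by auto
      then show "\<exists>d\<in>D. d \<in> S"
        using d(1) by blast
    qed
  qed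
  moreover have "generate_topology_on
      {{\<K>. compactin (lower_powerspace X) \<K> \<and> saturatedin (lower_powerspace X) \<K> \<and> \<K> \<subseteq> W}
      |W. openin (lower_powerspace X) W} T"
    using assms(2) by (simp add: Y_def upper_powerspace_def openin_topology_generated_by_iff)
  ultimately show ?thesis
    by (rule generate_topology_on_coarsest[OF istopology_scott_open_on])
qed

section \<open>Transfer from \<open>O(O(X))\<close> and the final assembly\<close>

lemma homeomorphic_open_set_space_order_iso:
  assumes sc: "second_countable X" and cons: "consonant X"
    and scott: "\<And>U. openin Y U \<Longrightarrow> scott_open_on (topspace Y) (specialization_le Y) U"
  defines "Z \<equiv> open_set_space (open_set_space X)"
  assumes iso: "order_iso_on (topspace Y) (specialization_le Y) (topspace Z) (specialization_le Z) f"
  shows "Y = weak_topology (topspace Y) (specialization_le Y)"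
    and "Y = scott_topology (topspace Y) (specialization_le Y)"
    and "Y homeomorphic_space Z"
proof -
  have Z: "weak_topology (topspace Z) (specialization_le Z)
      = scott_topology (topspace Z) (specialization_le Z)"
    unfolding Z_def by (rule weak_eq_scott_open_set_space[OF sc cons])
  note Yeq = topology_eq_weak_scott[OF scott weak_eq_scott_order_iso[OF iso Z]]
  show "Y = weak_topology (topspace Y) (specialization_le Y)"
    and "Y = scott_topology (topspace Y) (specialization_le Y)"
    using Yeq by simp_all
  have "Z = weak_topology (topspace Z) (specialization_le Z)"
    by (rule topology_eq_weak_scott(1)[OF _ Z])
      (unfold Z_def, rule scott_open_on_specialization_open_set_space[THEN iffD2])
  \<comment> \<open>Both spaces now carry the weak topology of their order, for which an order
    isomorphism is a homeomorphism.\<close>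
  then have "homeomorphic_map Y Z f"
    using homeomorphic_map_weak_topology[OF iso] Yeq(1) by simp
  then show "Y homeomorphic_space Z"
    by (rule homeomorphic_map_imp_homeomorphic_space)
qed

theorem corollary6p15:
  fixes X :: "'a topology"
  assumes "second_countable X" and "consonant X"
  shows "lower_powerspace (upper_powerspace X) homeomorphic_space
           upper_powerspace (lower_powerspace X) \<and>
         upper_powerspace (lower_powerspace X) homeomorphic_space
           open_set_space (open_set_space X) \<and>
         lower_powerspace (upper_powerspace X) homeomorphic_space
           open_set_space (open_set_space X) \<and>
         (\<forall>Z \<in> {lower_powerspace (upper_powerspace X),
                upper_powerspace (lower_powerspace X),
                open_set_space (open_set_space X)}.
            Z = weak_topology (topspace Z) (specialization_le Z) \<and>
            Z = scott_topology (topspace Z) (specialization_le Z))"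
proof -
  let ?AK = "lower_powerspace (upper_powerspace X)"
    and ?KA = "upper_powerspace (lower_powerspace X)"
    and ?OO = "open_set_space (open_set_space X)"
  have AK: "?AK = weak_topology (topspace ?AK) (specialization_le ?AK)"
    "?AK = scott_topology (topspace ?AK) (specialization_le ?AK)" "?AK homeomorphic_space ?OO"
    by (rule homeomorphic_open_set_space_order_iso[OF assms _
          order_iso_on_lower_upper_open_set_space[OF assms(2)]];
        erule scott_open_on_lower_powerspace)+
  have KA: "?KA = weak_topology (topspace ?KA) (specialization_le ?KA)"
    "?KA = scott_topology (topspace ?KA) (specialization_le ?KA)" "?KA homeomorphic_space ?OO"
    by (rule homeomorphic_open_set_space_order_iso[OF assms _
          order_iso_on_upper_lower_open_set_space];
        erule scott_open_on_upper_lower_powerspace)+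
  have OO: "?OO = weak_topology (topspace ?OO) (specialization_le ?OO)"
    "?OO = scott_topology (topspace ?OO) (specialization_le ?OO)"
    by (rule topology_eq_weak_scott[OF _ weak_eq_scott_open_set_space[OF assms]];
        erule scott_open_on_specialization_open_set_space[THEN iffD2])+
  show ?thesis
  proof (intro conjI AK(3) KA(3))
    show "?AK homeomorphic_space ?KA"
      using AK(3) KA(3)[THEN homeomorphic_space_sym[THEN iffD1]] by (rule homeomorphic_space_trans)
    \<comment> \<open>The equations in \<open>AK\<close>, \<open>KA\<close> and \<open>OO\<close>
      repeat their left sides on the right, so the cases are split by resolution instead of
      rewriting.\<close>
    have three: "P a \<Longrightarrow> P b \<Longrightarrow> P c \<Longrightarrow> \<forall>z\<in>{a, b, c}. P z" for P and a b c :: "'a set set topology"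
      by simp
    show "\<forall>Z \<in> {?AK, ?KA, ?OO}. Z = weak_topology (topspace Z) (specialization_le Z) \<and>
        Z = scott_topology (topspace Z) (specialization_le Z)"
      by (rule three; rule conjI) (rule AK KA OO)+
  qed
qed

end
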